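(* Let $\mathfrak g$ be a real simple Lie algebra whose complexification $\mathfrak g^{\mathbb C}$ is simple, $\mathfrak t$ a Cartan subalgebra of $\mathfrak g$, and $\Theta$ a Cartan involution of $\mathfrak g$ preserving $\mathfrak t$. Choose simple roots $\alpha_1,\ldots,\alpha_N$ for the root system $\Delta(\mathfrak g^{\mathbb C},\mathfrak t^{\mathbb C})$ and let $\sigma$ be the corresponding Coxeter automorphism of $\mathfrak g^{\mathbb C}$. Then the following are equivalent: (1) $\sigma$ preserves the real form $\mathfrak g$; (2) $\sigma$ commutes with $\Theta$; (3) $\Theta$ defines a permutation of the extended Dynkin diagram for $\mathfrak g^{\mathbb C}$ consisting of the usual Dynkin diagram augmented with the lowest root $\alpha_0$.
   Context: A Cartan involution of $\mathfrak g$ is an involution $\Theta$ of $\mathfrak g$ such that $\langle X,Y\rangle_\Theta=-\langle X,\Theta(Y)\rangle$ is positive definite, where $\langle\cdot,\cdot\rangle$ is the Killing form; $\Theta$ is extended complex-linearly to $\mathfrak g^{\mathbb C}$. It acts on roots by $\Theta(\alpha)(X)=\alpha(\Theta(X))$ for $X\in\mathfrak t^{\mathbb C}$. Condition (3) means that this action permutes the set $\{\alpha_0,\alpha_1,\ldots,\alpha_N\}$ of nodes of the extended Dynkin diagram. The height of a root $\alpha=\sum_{j=1}^N n_j\alpha_j$ is $h(\alpha)=\sum_{j=1}^N n_j$; $\alpha_0$ denotes the lowest root, i.e. the root of minimal height. Let $k-1$ be the maximal height of a root, and let $\eta_1,\ldots,\eta_N\in\mathfrak t^{\mathbb C}$ be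 the basis dual to the simple roots, $\alpha_i(\eta_j)=\delta_{ij}$. The Coxeter automorphism is $$\sigma=\mathrm{Ad}_{\exp\left(\frac{2\pi i}{k}\sum_{j=1}^N\eta_j\right)},$$ an automorphism of $\mathfrak g^{\mathbb C}$ of order $k$; it is the identity on $\mathfrak t^{\mathbb C}$ and multiplies each root vector of root $\alpha$ by $\exp(2\pi i\,h(\alpha)/k)$. "$\sigma$ preserves $\mathfrak g$" means $\sigma(\mathfrak g)=\mathfrak g$. *)

theory Defs
  imports Complex_Main "HOL-Library.Product_Plus"
begin

section \<open>Endomorphisms of finite-dimensional vector spaces\<close>

context vector_space
begin

text \<open>The trace is computed in one chosen basis of the whole space; in finite dimension its value
  does not depend on the choice.\<close>

definition endo_trace :: "('b \<Rightarrow> 'b) \<Rightarrow> 'a" where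
  "endo_trace f = (\<Sum>b\<in>extend_basis {}. representation (extend_basis {}) (f b) b)"

end

text \<open>The exponential series \<open>\<Sum>n. f\<^sup>n / n!\<close> of a linear endomorphism of a finite-dimensional complex
  vector space. No topology is assumed on the space, so the series is summed coordinatewise in
  one chosen basis; again the result does not depend on the choice.\<close>

definition endo_exp ::
    "(complex \<Rightarrow> 'v::ab_group_add \<Rightarrow> 'v) \<Rightarrow> ('v \<Rightarrow> 'v) \<Rightarrow> 'v \<Rightarrow> 'v" where
  "endo_exp scale f v =
     (let B = vector_space.extend_basis scale {} in
      \<Sum>b\<in>B. scale (\<Sum>n. module.representation scale B ((f ^^ n) v) b / fact n) b)"


section \<open>Lie algebras\<close>

locale lie_algebra = vector_space scale
  for scale :: "'k::field \<Rightarrow> 'v::ab_group_add \<Rightarrow> 'v" +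
  fixes bracket :: "'v \<Rightarrow> 'v \<Rightarrow> 'v"
  assumes bracket_linear_right: "Vector_Spaces.linear scale scale (\<lambda>y. bracket x y)"
    and bracket_linear_left: "Vector_Spaces.linear scale scale (\<lambda>x. bracket x y)"
    and bracket_self: "bracket x x = 0"
    and jacobi: "bracket x (bracket y z) + bracket y (bracket z x) + bracket z (bracket x y) = 0"
begin

definition lie_subalgebra :: "'v set \<Rightarrow> bool" where
  "lie_subalgebra S \<longleftrightarrow> subspace S \<and> (\<forall>x\<in>S. \<forall>y\<in>S. bracket x y \<in> S)"

definition lie_ideal :: "'v set \<Rightarrow> bool" where
  "lie_ideal I \<longleftrightarrow> subspace I \<and> (\<forall>x. \<forall>y\<in>I. bracket x y \<in> I)"

definition simple :: bool where
  "simple \<longleftrightarrow> (\<exists>x y. bracket x y \<noteq> 0) \<and> (\<forall>I. lie_ideal I \<longrightarrow> I = {0} \<or> I = UNIV)"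

definition normalizer :: "'v set \<Rightarrow> 'v set" where
  "normalizer S = {x. \<forall>y\<in>S. bracket x y \<in> S}"

primrec lower_central :: "'v set \<Rightarrow> nat \<Rightarrow> 'v set" where
  "lower_central S 0 = S"
| "lower_central S (Suc n) = span {bracket x y |x y. x \<in> S \<and> y \<in> lower_central S n}"

definition nilpotent :: "'v set \<Rightarrow> bool" where
  "nilpotent S \<longleftrightarrow> (\<exists>n. lower_central S n = {0})"

definition cartan_subalgebra :: "'v set \<Rightarrow> bool" where
  "cartan_subalgebra H \<longleftrightarrow> lie_subalgebra H \<and> nilpotent H \<and> normalizer H = H"

definition killing :: "'v \<Rightarrow> 'v \<Rightarrow> 'k" where
  "killing x y = endo_trace (bracket x \<circ> bracket y)"

definition lie_automorphism :: "('v \<Rightarrow> 'v) \<Rightarrow> bool" where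
  "lie_automorphism f \<longleftrightarrow> Vector_Spaces.linear scale scale f \<and> bij f \<and>
     (\<forall>x y. f (bracket x y) = bracket (f x) (f y))"

end

locale finite_dim_lie_algebra = lie_algebra +
  assumes finite_dim: "\<exists>B. finite B \<and> span B = UNIV"


section \<open>Roots and the Coxeter automorphism\<close>

locale complex_lie_algebra = lie_algebra scale bracket
  for scale :: "complex \<Rightarrow> 'v::ab_group_add \<Rightarrow> 'v" and bracket
begin

text \<open>An element of the dual space of a subspace \<open>H\<close> is represented by the function on the whole
  space that agrees with it on \<open>H\<close> and vanishes outside \<open>H\<close>, so that equal functionals on
  \<open>H\<close> are equal functions.\<close>

definition dual_on :: "'v set \<Rightarrow> ('v \<Rightarrow> complex) set" where
  "dual_on H = {\<alpha>. (\<forall>x\<in>H. \<forall>y\<in>H. \<alpha> (x + y) = \<alpha> x + \<alpha> y) \<and>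
                  (\<forall>c. \<forall>x\<in>H. \<alpha> (scale c x) = c * \<alpha> x) \<and> (\<forall>x. x \<notin> H \<longrightarrow> \<alpha> x = 0)}"

definition roots :: "'v set \<Rightarrow> ('v \<Rightarrow> complex) set" where
  "roots H = {\<alpha> \<in> dual_on H. (\<exists>x\<in>H. \<alpha> x \<noteq> 0) \<and>
                (\<exists>X. X \<noteq> 0 \<and> (\<forall>h\<in>H. bracket h X = scale (\<alpha> h) X))}"

text \<open>\<open>\<alpha> 1, \<dots>, \<alpha> N\<close> are a base of the root system: a linearly independent family of roots such
  that every root is an integral combination of it with coefficients of one sign.\<close>

definition simple_roots :: "'v set \<Rightarrow> nat \<Rightarrow> (nat \<Rightarrow> 'v \<Rightarrow> complex) \<Rightarrow> bool" where
  "simple_roots H N \<alpha> \<longleftrightarrow>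
     (\<forall>i\<in>{1..N}. \<alpha> i \<in> roots H) \<and>
     (\<forall>c. (\<forall>x\<in>H. (\<Sum>i=1..N. c i * \<alpha> i x) = 0) \<longrightarrow> (\<forall>i\<in>{1..N}. c i = 0)) \<and>
     (\<forall>\<beta>\<in>roots H. \<exists>n :: nat \<Rightarrow> int.
        (\<forall>x. \<beta> x = (\<Sum>i=1..N. of_int (n i) * \<alpha> i x)) \<and>
        ((\<forall>i\<in>{1..N}. 0 \<le> n i) \<or> (\<forall>i\<in>{1..N}. n i \<le> 0)))"

definition height :: "nat \<Rightarrow> (nat \<Rightarrow> 'v \<Rightarrow> complex) \<Rightarrow> ('v \<Rightarrow> complex) \<Rightarrow> int" where
  "height N \<alpha> \<beta> = (THE m. \<exists>n :: nat \<Rightarrow> int.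
     (\<forall>x. \<beta> x = (\<Sum>i=1..N. of_int (n i) * \<alpha> i x)) \<and> m = (\<Sum>i=1..N. n i))"

definition lowest_root :: "'v set \<Rightarrow> nat \<Rightarrow> (nat \<Rightarrow> 'v \<Rightarrow> complex) \<Rightarrow> 'v \<Rightarrow> complex" where
  "lowest_root H N \<alpha> = (THE \<beta>. \<beta> \<in> roots H \<and> (\<forall>\<gamma>\<in>roots H. height N \<alpha> \<beta> \<le> height N \<alpha> \<gamma>))"

definition extended_nodes ::
    "'v set \<Rightarrow> nat \<Rightarrow> (nat \<Rightarrow> 'v \<Rightarrow> complex) \<Rightarrow> ('v \<Rightarrow> complex) set" where
  "extended_nodes H N \<alpha> = insert (lowest_root H N \<alpha>) (\<alpha> ` {1..N})"

definition coxeter_number :: "'v set \<Rightarrow> nat \<Rightarrow> (nat \<Rightarrow> 'v \<Rightarrow> complex) \<Rightarrow> int" where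
  "coxeter_number H N \<alpha> = Max (height N \<alpha> ` roots H) + 1"

definition dual_basis :: "'v set \<Rightarrow> nat \<Rightarrow> (nat \<Rightarrow> 'v \<Rightarrow> complex) \<Rightarrow> nat \<Rightarrow> 'v" where
  "dual_basis H N \<alpha> j =
     (THE \<eta>. \<eta> \<in> H \<and> (\<forall>i\<in>{1..N}. \<alpha> i \<eta> = (if i = j then 1 else 0)))"

text \<open>\<open>Ad\<close> of the group element \<open>exp X\<close>, which equals the exponential of \<open>ad X\<close>.\<close>

definition Ad_exp :: "'v \<Rightarrow> 'v \<Rightarrow> 'v" where
  "Ad_exp X = endo_exp scale (bracket X)"

definition coxeter_automorphism :: "'v set \<Rightarrow> nat \<Rightarrow> (nat \<Rightarrow> 'v \<Rightarrow> complex) \<Rightarrow> 'v \<Rightarrow> 'v" where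
  "coxeter_automorphism H N \<alpha> =
     Ad_exp (scale (2 * of_real pi * \<i> / of_int (coxeter_number H N \<alpha>))
                   (\<Sum>j=1..N. dual_basis H N \<alpha> j))"

end


section \<open>Real Lie algebras and their complexification\<close>

text \<open>Positive definiteness only needs to be asked on the diagonal: for an involutive automorphism
  \<open>\<Theta>\<close> the form \<open>(X, Y) \<mapsto> - killing X (\<Theta> Y)\<close> is automatically bilinear and symmetric. The
  identity is allowed; it is the Cartan involution of a compact real form.\<close>

definition cartan_involution :: "('a::real_vector \<Rightarrow> 'a \<Rightarrow> 'a) \<Rightarrow> ('a \<Rightarrow> 'a) \<Rightarrow> bool" where
  "cartan_involution br \<Theta> \<longleftrightarrow>
     lie_algebra.lie_automorphism scaleR br \<Theta> \<and> \<Theta> \<circ> \<Theta> = id \<and>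
     (\<forall>X. X \<noteq> 0 \<longrightarrow> - lie_algebra.killing scaleR br X (\<Theta> X) > 0)"

text \<open>The pair \<open>(x, y)\<close> stands for \<open>x + \<i> y\<close>. Hence the complexification of a subspace \<open>S\<close> is
  \<open>S \<times> S\<close>, and the complex-linear extension of a linear map \<open>f\<close> is \<open>map_prod f f\<close>.\<close>

definition cscale :: "complex \<Rightarrow> 'a::real_vector \<times> 'a \<Rightarrow> 'a \<times> 'a" where
  "cscale c = (\<lambda>(x, y). (Re c *\<^sub>R x - Im c *\<^sub>R y, Re c *\<^sub>R y + Im c *\<^sub>R x))"

definition cbracket ::
    "('a::real_vector \<Rightarrow> 'a \<Rightarrow> 'a) \<Rightarrow> 'a \<times> 'a \<Rightarrow> 'a \<times> 'a \<Rightarrow> 'a \<times> 'a" where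
  "cbracket br = (\<lambda>(x, y) (u, v). (br x u - br y v, br x v + br y u))"

definition real_form :: "('a::real_vector \<times> 'a) set" where
  "real_form = range (\<lambda>x. (x, 0))"

lemma vector_space_cscale: "vector_space (cscale :: complex \<Rightarrow> 'a::real_vector \<times> 'a \<Rightarrow> 'a \<times> 'a)"
  by unfold_locales (auto simp: cscale_def algebra_simps)

lemma complex_lie_algebra_complexification:
  fixes br :: "'a::real_vector \<Rightarrow> 'a \<Rightarrow> 'a"
  assumes "lie_algebra scaleR br"
  shows "complex_lie_algebra cscale (cbracket br)"
proof -
  interpret g: lie_algebra scaleR br by fact
  interpret C: vector_space "cscale :: complex \<Rightarrow> 'a \<times> 'a \<Rightarrow> 'a \<times> 'a"
    by (rule vector_space_cscale)
  have addr: "br x (y + z) = br x y + br x z" and scr: "br x (r *\<^sub>R y) = r *\<^sub>R br x y" for x y z r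
    using Vector_Spaces.linear.axioms(3)[OF g.bracket_linear_right[of x]]
    by (auto simp: module_hom_def module_hom_axioms_def)
  have addl: "br (x + y) z = br x z + br y z" and scl: "br (r *\<^sub>R x) z = r *\<^sub>R br x z" for x y z r
    using Vector_Spaces.linear.axioms(3)[OF g.bracket_linear_left[of z]]
    by (auto simp: module_hom_def module_hom_axioms_def)
  have subr: "br x (y - z) = br x y - br x z" for x y z
    using addr[of x "y - z" z] by simp
  have subl: "br (x - y) z = br x z - br y z" for x y z
    using addl[of "x - y" y z] by simp
  have anti: "br x y = - br y x" for x y
    using g.bracket_self[of "x + y"] g.bracket_self[of x] g.bracket_self[of y]
    by (simp add: addl addr eq_neg_iff_add_eq_0 add.commute)
  define J where "J x y z = br x (br y z) + br y (br z x) + br z (br x y)" for x y z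
  have J: "J x y z = 0" for x y z
    using g.jacobi by (simp add: J_def)
  show ?thesis
  proof unfold_locales
    fix x y z :: "'a \<times> 'a" and c
    show "cbracket br x (y + z) = cbracket br x y + cbracket br x z"
      "cbracket br (y + z) x = cbracket br y x + cbracket br z x"
      "cbracket br x (cscale c y) = cscale c (cbracket br x y)"
      "cbracket br (cscale c y) x = cscale c (cbracket br y x)"
      by (cases x; cases y; cases z;
          simp add: cbracket_def cscale_def addr addl subr subl scr scl algebra_simps)+
    show "cbracket br x x = 0"
      using anti[of "fst x" "snd x"]
      by (cases x) (simp add: cbracket_def g.bracket_self zero_prod_def)
    obtain a a' b b' d d' where [simp]: "x = (a, a')" "y = (b, b')" "z = (d, d')"
      by (cases x, cases y, cases z) blast
    have "cbracket br x (cbracket br y z) + cbracket br y (cbracket br z x)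
        + cbracket br z (cbracket br x y) =
        (J a b d - J a b' d' - J a' b d' - J a' b' d, J a b d' + J a b' d + J a' b d - J a' b' d')"
      by (simp add: cbracket_def J_def addr subr algebra_simps)
    then show "cbracket br x (cbracket br y z) + cbracket br y (cbracket br z x)
        + cbracket br z (cbracket br x y) = 0"
      by (simp add: J zero_prod_def)
  qed
qed

end

theory Submission
  imports Defs "HOL-Computational_Algebra.Fundamental_Theorem_Algebra"
    "HOL-Analysis.Complex_Transcendental"
begin

text \<open>Let \<open>\<tau>\<close> be the composition of \<open>\<Theta>\<close> with the conjugation of the complexification. It is the
  conjugation with respect to a compact real form, so every \<open>ad X\<close> has adjoint \<open>- ad (\<tau> X)\<close> for the
  positive definite Hermitian form given by the Killing form and \<open>\<tau>\<close>. As the Cartan subalgebra is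
  stable under \<open>\<tau>\<close>, its adjoint action is by commuting normal operators, which yields an orthogonal
  root space decomposition, and \<open>\<tau>\<close> maps the root space of \<open>\<beta>\<close> to that of \<open>- \<beta>\<close>.

  The Coxeter automorphism multiplies that root space by \<open>\<zeta>\<close> to the power of the height of \<open>\<beta>\<close>, with
  \<open>\<zeta>\<close> a primitive \<open>k\<close>-th root of unity. Since \<open>\<tau>\<close> is antilinear and negates heights, \<open>\<sigma>\<close> commutes
  with \<open>\<tau>\<close>; hence it commutes with the conjugation, i.e. preserves the real form, iff it commutes
  with \<open>\<Theta>\<close>. The latter says that \<open>\<Theta>\<close> preserves all heights modulo \<open>k\<close>. As heights are additive it
  suffices to check this on simple roots, and the roots of height congruent to \<open>1\<close> are those of
  height \<open>1\<close> or \<open>1 - k\<close>, which are the nodes of the extended diagram.\<close>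

section \<open>Traces and eigenvectors\<close>

context vector_space
begin

lemma finite_extend_basis_empty:
  assumes "\<exists>B. finite B \<and> span B = UNIV"
  shows "finite (extend_basis {})"
  using assms independent_span_bound independent_extend_basis[OF independent_empty] by blast

lemma finite_dimensional_extend_basis:
  assumes "\<exists>B. finite B \<and> span B = UNIV"
  shows "finite_dimensional_vector_space scale (extend_basis {})"
  using finite_extend_basis_empty[OF assms] independent_extend_basis[OF independent_empty]
  by unfold_locales (auto simp: independent_empty)

text \<open>In matrix entries the trace of a composite is a double sum that is unchanged when the
  two maps, and with them the two summation indices, are exchanged.\<close>

lemma endo_trace_comp_commute:
  assumes fin: "\<exists>B. finite B \<and> span B = UNIV"
    and f: "Vector_Spaces.linear scale scale f" and g: "Vector_Spaces.linear scale scale g"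
  shows "endo_trace (f \<circ> g) = endo_trace (g \<circ> f)"
proof -
  interpret finite_dimensional_vector_space scale "extend_basis {}"
    by (rule finite_dimensional_extend_basis[OF fin])
  define B where "B = extend_basis {}"
  have B: "finite B" "independent B" "span B = UNIV"
    using finite_Basis independent_Basis span_Basis by (auto simp: B_def)
  have *: "endo_trace (f \<circ> g) =
      (\<Sum>b\<in>B. \<Sum>c\<in>B. representation B (g b) c * representation B (f c) b)"
    if f: "Vector_Spaces.linear scale scale f" for f g
  proof -
    interpret f: Vector_Spaces.linear scale scale f by fact
    have "representation B (f (g b)) b =
        (\<Sum>c\<in>B. representation B (g b) c * representation B (f c) b)" for b
    proof -
      have "f (g b) = f (\<Sum>c\<in>B. scale (representation B (g b) c) c)"
        using B by (simp add: sum_representation_eq)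
      also have "\<dots> = (\<Sum>c\<in>B. scale (representation B (g b) c) (f c))"
        by (simp add: f.sum f.scale)
      finally show ?thesis using B
        by (simp add: representation_sum representation_scale)
    qed
    then show ?thesis by (simp add: endo_trace_def B_def)
  qed
  show ?thesis
    unfolding *[OF f] *[OF g] by (subst sum.swap) (simp add: mult.commute)
qed

lemma
  shows endo_trace_diff: "endo_trace (\<lambda>x. f x - g x) = endo_trace f - endo_trace g"
    and endo_trace_add: "endo_trace (\<lambda>x. f x + g x) = endo_trace f + endo_trace g"
    and endo_trace_scale: "endo_trace (\<lambda>x. scale c (f x)) = c * endo_trace f"
  using independent_extend_basis[OF independent_empty] span_extend_basis[OF independent_empty]
  by (simp_all add: endo_trace_def representation_diff representation_add representation_scale
      sum_subtractf sum.distrib sum_distrib_left)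

text \<open>Induction on the index set, in the manner of Gram-Schmidt: project a vector into the
  common kernel of the old functionals, normalize it against the new one, then correct the old dual
  vectors. It provides the basis dual to the simple roots. Linearity is asked on \<open>H\<close>
  only, since roots are extended by zero outside \<open>H\<close>.\<close>

lemma independent_dual_family:
  fixes \<phi> :: "'i \<Rightarrow> 'b \<Rightarrow> 'a"
  assumes "finite I" and H: "subspace H"
    and add: "\<And>i x y. i \<in> I \<Longrightarrow> x \<in> H \<Longrightarrow> y \<in> H \<Longrightarrow> \<phi> i (x + y) = \<phi> i x + \<phi> i y"
    and scl: "\<And>i c x. i \<in> I \<Longrightarrow> x \<in> H \<Longrightarrow> \<phi> i (scale c x) = c * \<phi> i x"
    and "\<And>c. (\<And>x. x \<in> H \<Longrightarrow> (\<Sum>i\<in>I. c i * \<phi> i x) = 0) \<Longrightarrow> (\<forall>i\<in>I. c i = 0)"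
  shows "\<exists>e. \<forall>j\<in>I. e j \<in> H \<and> (\<forall>i\<in>I. \<phi> i (e j) = (if i = j then 1 else 0))"
  using assms(1) add scl assms(5)
proof (induction I rule: finite_induct)
  case empty
  then show ?case by auto
next
  case (insert m I)
  have phi0: "\<phi> i 0 = 0" if "i \<in> insert m I" for i
    using insert.prems(2)[of i 0 0] that subspace_0[OF H] by simp
  have phis: "\<phi> i (\<Sum>j\<in>J. scale (a j) (e j)) = (\<Sum>j\<in>J. a j * \<phi> i (e j))"
    if "i \<in> insert m I" "finite J" "\<And>j. j \<in> J \<Longrightarrow> e j \<in> H" for i J a e
    using that(2,3)
    by (induction J rule: finite_induct)
      (simp_all add: phi0[OF that(1)] insert.prems(1,2)[OF that(1)] subspace_sum[OF H] subspace_scale[OF H])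
  have "\<exists>e. \<forall>j\<in>I. e j \<in> H \<and> (\<forall>i\<in>I. \<phi> i (e j) = (if i = j then 1 else 0))"
  proof (rule insert.IH)
    fix c assume c: "\<And>x. x \<in> H \<Longrightarrow> (\<Sum>i\<in>I. c i * \<phi> i x) = 0"
    have "\<forall>i\<in>insert m I. (if i = m then 0 else c i) = 0"
    proof (rule insert.prems(3))
      fix x assume "x \<in> H"
      have "(\<Sum>i\<in>I. (if i = m then 0 else c i) * \<phi> i x) = (\<Sum>i\<in>I. c i * \<phi> i x)"
        using insert.hyps by (intro sum.cong) auto
      then show "(\<Sum>i\<in>insert m I. (if i = m then 0 else c i) * \<phi> i x) = 0"
        using c[OF \<open>x \<in> H\<close>] insert.hyps by simp
    qed
    then show "\<forall>i\<in>I. c i = 0" using insert.hyps by (auto split: if_splits)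
  qed (use insert.prems in auto)
  then obtain e where e: "\<And>j. j \<in> I \<Longrightarrow> e j \<in> H"
      "\<And>i j. j \<in> I \<Longrightarrow> i \<in> I \<Longrightarrow> \<phi> i (e j) = (if i = j then 1 else 0)" by blast
  \<comment> \<open>\<open>r\<close> projects \<open>H\<close> onto the common kernel of the
    functionals indexed by \<open>I\<close>, along the vectors \<open>e j\<close>.\<close>
  define r where "r x = x + (\<Sum>j\<in>I. scale (- \<phi> j x) (e j))" for x
  have rH: "r x \<in> H" if "x \<in> H" for x
    unfolding r_def using that e(1) by (intro subspace_add[OF H] subspace_sum[OF H] subspace_scale[OF H])
  have phir: "\<phi> i (r x) = \<phi> i x - (\<Sum>j\<in>I. \<phi> j x * \<phi> i (e j))" if "i \<in> insert m I" "x \<in> H" for i x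
  proof -
    have "\<phi> i (r x) = \<phi> i x + \<phi> i (\<Sum>j\<in>I. scale (- \<phi> j x) (e j))"
      unfolding r_def using that e(1)
      by (intro insert.prems(1) subspace_sum[OF H] subspace_scale[OF H])
    also have "\<phi> i (\<Sum>j\<in>I. scale (- \<phi> j x) (e j)) = (\<Sum>j\<in>I. - \<phi> j x * \<phi> i (e j))"
      by (rule phis[OF that(1) insert.hyps(1) e(1)])
    finally show ?thesis by (simp add: sum_negf)
  qed
  have "\<exists>x\<in>H. \<phi> m (r x) \<noteq> 0"
  proof (rule ccontr)
    assume "\<not> ?thesis"
    then have *: "\<phi> m x = (\<Sum>j\<in>I. \<phi> j x * \<phi> m (e j))" if "x \<in> H" for x
      using phir[of m x] that by auto
    \<comment> \<open>If \<open>\<phi> m\<close> vanished on the image of \<open>r\<close>, it would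
      be a combination of the other functionals; these are the coefficients of the resulting
      relation.\<close>
    have "\<forall>i\<in>insert m I. (if i = m then 1 else - \<phi> m (e i)) = 0"
    proof (rule insert.prems(3))
      fix x assume "x \<in> H"
      have "(\<Sum>i\<in>I. (if i = m then 1 else - \<phi> m (e i)) * \<phi> i x) = (\<Sum>i\<in>I. - (\<phi> i x * \<phi> m (e i)))"
        using insert.hyps by (intro sum.cong) auto
      then show "(\<Sum>i\<in>insert m I. (if i = m then 1 else - \<phi> m (e i)) * \<phi> i x) = 0"
        using *[OF \<open>x \<in> H\<close>] insert.hyps by (simp add: sum_negf)
    qed
    then show False by auto
  qed
  then obtain x where x: "x \<in> H" "\<phi> m (r x) \<noteq> 0" by blast
  define em where "em = scale (1 / \<phi> m (r x)) (r x)"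
  have em: "em \<in> H" "\<phi> m em = 1" "\<And>i. i \<in> I \<Longrightarrow> \<phi> i em = 0"
  proof -
    show "em \<in> H" "\<phi> m em = 1"
      using rH[OF x(1)] x(2) by (auto simp: em_def insert.prems(2) subspace_scale[OF H])
    fix i assume i: "i \<in> I"
    have "(\<Sum>j\<in>I. \<phi> j x * \<phi> i (e j)) = (\<Sum>j\<in>I. if i = j then \<phi> j x else 0)"
      using e(2) i by (intro sum.cong) auto
    then have "\<phi> i (r x) = 0" using phir[of i x] i x(1) insert.hyps(1) by simp
    then show "\<phi> i em = 0" using rH[OF x(1)] i by (simp add: em_def insert.prems(2))
  qed
  \<comment> \<open>Subtracting a multiple of \<open>em\<close> makes \<open>\<phi> m\<close> vanish
    without changing the values of the old functionals.\<close>
  define e' where "e' j = (if j = m then em else e j + scale (- \<phi> m (e j)) em)" for j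
  have "e' j \<in> H \<and> (\<forall>i\<in>insert m I. \<phi> i (e' j) = (if i = j then 1 else 0))" if "j \<in> insert m I" for j
  proof (cases "j = m")
    case True
    then show ?thesis using em insert.hyps by (auto simp: e'_def)
  next
    case False
    then have j: "j \<in> I" using that by auto
    have "\<phi> i (e' j) = \<phi> i (e j) - \<phi> m (e j) * \<phi> i em" if "i \<in> insert m I" for i
      using that False e(1)[OF j] em(1)
      by (simp add: e'_def insert.prems(1,2)[OF that] subspace_scale[OF H] del: scale_minus_left)
    then show ?thesis using False j e em insert.hyps
      by (auto simp: e'_def subspace_add[OF H] subspace_scale[OF H] subspace_diff[OF H])
  qed
  then show ?case by blast
qed

end

text \<open>Take a nonzero polynomial \<open>p\<close> of least degree with p(A) v = 0. It has a
  complex root \<open>c\<close>; dividing by the linear factor leaves \<open>q\<close> with q(A) v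
  nonzero by minimality, and this vector is an eigenvector for \<open>c\<close>. It stays in
  \<open>M\<close> because \<open>M\<close> is invariant.\<close>

lemma exists_eigenvector_complex:
  fixes scale :: "complex \<Rightarrow> 'v::ab_group_add \<Rightarrow> 'v"
  assumes "finite_dimensional_vector_space scale B"
    and A: "Vector_Spaces.linear scale scale A"
    and M: "module.subspace scale M" "A ` M \<subseteq> M" "M \<noteq> {0}"
  shows "\<exists>v\<in>M. \<exists>c. v \<noteq> 0 \<and> A v = scale c v"
proof -
  interpret finite_dimensional_vector_space scale B by fact
  interpret A: Vector_Spaces.linear scale scale A by fact
  obtain v where v: "v \<in> M" "v \<noteq> 0" using M subspace_0[OF M(1)] by blast
  \<comment> \<open>Horner evaluation of p(A) v.\<close>
  define act where "act p = fold_coeffs (\<lambda>a w. scale a v + A w) p 0" for p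
  have act_0 [simp]: "act 0 = 0" by (simp add: act_def)
  have act_pCons [simp]: "act (pCons a p) = scale a v + A (act p)" for a p
    by (cases "p = 0 \<and> a = 0") (auto simp: act_def A.zero)
  have act_add: "act (p + q) = act p + act q" for p q
    by (induction p q rule: poly_induct2) (simp_all add: scale_left_distrib A.add)
  have act_smult: "act (smult c p) = scale c (act p)" for c p
    by (induction p) (simp_all add: scale_right_distrib A.scale)
  have act_M: "act p \<in> M" for p
    by (induction p) (use M v in \<open>auto simp: subspace_0 intro!: subspace_add subspace_scale\<close>)
  have act_linear: "Vector_Spaces.linear smult scale act"
    by (auto simp: Vector_Spaces.linear_iff act_add act_smult vector_space_axioms
        intro!: vector_space.intro simp: smult_add_left smult_add_right)
  have "\<exists>p. p \<noteq> 0 \<and> act p = 0"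
  proof (rule ccontr)
    assume neg: "\<not> ?thesis"
    \<comment> \<open>If no nonzero polynomial kills \<open>v\<close>, the powers of
      \<open>A\<close> up to \<open>card B\<close> give \<open>card B + 1\<close> distinct vectors;
      a dependence among them is an annihilating polynomial after all.\<close>
    define S where "S = (\<lambda>i. act (monom 1 i)) ` {..card B}"
    have inj: "inj (\<lambda>i. act (monom 1 i))"
    proof (rule injI, rule ccontr)
      fix i j :: nat assume "act (monom 1 i) = act (monom 1 j)" "i \<noteq> j"
      then have "act (monom 1 i + smult (-1) (monom 1 j)) = 0"
        unfolding act_add act_smult by simp
      then have "monom (1::complex) i + smult (-1) (monom 1 j) = 0" using neg by blast
      then have "coeff (monom (1::complex) i + smult (-1) (monom 1 j)) i = 0" by (simp only: coeff_0)
      with \<open>i \<noteq> j\<close> show False by simp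
    qed
    have "dependent S"
    proof (rule ccontr)
      assume "\<not> dependent S"
      then have "card S \<le> card B"
        using independent_span_bound[OF finite_Basis] span_Basis by auto
      moreover have "card S = Suc (card B)"
        unfolding S_def by (subst card_image) (use inj in \<open>auto intro: inj_on_subset\<close>)
      ultimately show False by simp
    qed
    then obtain u where u: "(\<Sum>w\<in>S. scale (u w) w) = 0" "\<exists>w\<in>S. u w \<noteq> 0"
      unfolding S_def by (subst (asm) dependent_finite) auto
    define p where "p = (\<Sum>i\<le>card B. smult (u (act (monom 1 i))) (monom 1 i))"
    have "act (\<Sum>i\<in>J. f i) = (\<Sum>i\<in>J. act (f i))" if "finite J" for f and J :: "nat set"
      using that by (induction J rule: finite_induct) (simp_all add: act_add)
    then have "act p = (\<Sum>i\<le>card B. scale (u (act (monom 1 i))) (act (monom 1 i)))"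
      by (simp add: p_def act_smult)
    also have "\<dots> = (\<Sum>w\<in>S. scale (u w) w)"
      unfolding S_def by (subst sum.reindex) (use inj in \<open>auto intro: inj_on_subset\<close>)
    finally have "p = 0" using u(1) neg by auto
    obtain i where i: "i \<le> card B" "u (act (monom 1 i)) \<noteq> 0" using u(2) by (auto simp: S_def)
    have "coeff p i = (\<Sum>j\<le>card B. if j = i then u (act (monom 1 j)) else 0)"
      unfolding p_def coeff_sum by (intro sum.cong) auto
    then have "coeff p i = u (act (monom 1 i))" using i(1) by simp
    with \<open>p = 0\<close> i(2) show False by simp
  qed
  then obtain p where p: "p \<noteq> 0" "act p = 0" "\<And>q. q \<noteq> 0 \<and> act q = 0 \<Longrightarrow> degree p \<le> degree q"
    using exists_least_iff[of "\<lambda>d. \<exists>p. p \<noteq> 0 \<and> act p = 0 \<and> degree p = d"]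
    by (metis not_less)
  have "\<not> constant (poly p)"
  proof
    assume "constant (poly p)"
    then have "degree p = 0" by (simp add: constant_degree)
    then obtain a where "p = [:a:]" by (auto elim: degree_eq_zeroE)
    with p v show False by (auto simp: A.zero)
  qed
  then obtain c where "poly p c = 0" using fundamental_theorem_of_algebra by blast
  then obtain q where q: "p = [:-c, 1:] * q" by (auto simp: poly_eq_0_iff_dvd)
  with p(1) have "q \<noteq> 0" by auto
  then have "degree q < degree p" unfolding q by (subst degree_mult_eq) auto
  then have "act q \<noteq> 0" using p(3)[of q] \<open>q \<noteq> 0\<close> by auto
  moreover have "act p = scale (- c) (act q) + A (act q)"
  proof -
    have "p = smult (- c) q + pCons 0 q" unfolding q by simp
    then show ?thesis by (simp only: act_add act_smult act_pCons) simp
  qed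
  then have "A (act q) = scale c (act q)" using p(2) by (simp add: scale_minus_left)
  ultimately show ?thesis using act_M by blast
qed

section \<open>Root space decomposition\<close>

context lie_algebra
begin

lemma bracket_linear_simps:
  shows bracket_add_left: "bracket (x + y) z = bracket x z + bracket y z"
    and bracket_add_right: "bracket x (y + z) = bracket x y + bracket x z"
    and bracket_scale_left: "bracket (scale c x) z = scale c (bracket x z)"
    and bracket_scale_right: "bracket x (scale c z) = scale c (bracket x z)"
    and bracket_zero_left: "bracket 0 z = 0"
    and bracket_zero_right: "bracket x 0 = 0"
proof -
  interpret l: Vector_Spaces.linear scale scale "\<lambda>x. bracket x z" by (rule bracket_linear_left)
  interpret r: Vector_Spaces.linear scale scale "\<lambda>y. bracket x y" by (rule bracket_linear_right)
  show "bracket (x + y) z = bracket x z + bracket y z" "bracket x (y + z) = bracket x y + bracket x z"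
    "bracket (scale c x) z = scale c (bracket x z)" "bracket x (scale c z) = scale c (bracket x z)"
    "bracket 0 z = 0" "bracket x 0 = 0"
    by (fact l.add r.add l.scale r.scale l.zero r.zero)+
qed

lemma bracket_antisym: "bracket y x = - bracket x y"
  using bracket_self[of "x + y"] bracket_self[of x] bracket_self[of y]
  by (simp add: bracket_linear_simps eq_neg_iff_add_eq_0 add.commute)

lemma bracket_minus_right: "bracket x (- y) = - bracket x y"
  using bracket_add_right[of x y "- y"] by (simp add: bracket_zero_right eq_neg_iff_add_eq_0 add.commute)

lemma
  shows bracket_diff_left: "bracket (x - y) z = bracket x z - bracket y z"
    and bracket_diff_right: "bracket z (x - y) = bracket z x - bracket z y"
  using bracket_add_left[of "x - y" y z] bracket_add_right[of z "x - y" y] by simp_all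

lemma bracket_minus_left: "bracket (- x) z = - bracket x z"
  using bracket_diff_left[of 0 x z] by (simp add: bracket_zero_left)

lemma bracket_derivation:
  "bracket x (bracket y z) = bracket (bracket x y) z + bracket y (bracket x z)"
proof -
  have "bracket x (bracket y z) = - (bracket y (bracket z x) + bracket z (bracket x y))"
    using jacobi[of x y z] by (simp only: eq_neg_iff_add_eq_0 add.assoc)
  then show ?thesis
    using bracket_antisym[of "bracket x y" z] bracket_antisym[of z x] by (simp add: bracket_minus_right)
qed

end

text \<open>The conjugation \<open>\<tau>\<close> with respect to a compact real form makes \<open>ad\<close> of the compact
  form skew-Hermitian; this replaces the general structure theory of semisimple Lie algebras.\<close>

locale hermitian_cartan = complex_lie_algebra scale bracket
  for scale :: "complex \<Rightarrow> 'v::ab_group_add \<Rightarrow> 'v" and bracket +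
  fixes \<tau> :: "'v \<Rightarrow> 'v" and form :: "'v \<Rightarrow> 'v \<Rightarrow> complex" and H :: "'v set"
  assumes finite_dim: "\<exists>B. finite B \<and> span B = UNIV"
    and is_simple: "simple"
    and tau_tau: "\<tau> (\<tau> x) = x"
    and tau_add: "\<tau> (x + y) = \<tau> x + \<tau> y"
    and tau_scale: "\<tau> (scale c x) = scale (cnj c) (\<tau> x)"
    and tau_bracket: "\<tau> (bracket x y) = bracket (\<tau> x) (\<tau> y)"
    and form_add_left: "form (x + y) z = form x z + form y z"
    and form_scale_left: "form (scale c x) z = c * form x z"
    and form_sym: "form y x = cnj (form x y)"
    and form_definite: "form x x = 0 \<Longrightarrow> x = 0"
    and form_bracket: "form (bracket z x) y = - form x (bracket (\<tau> z) y)"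
    and subspace_H: "subspace H"
    and tau_H: "h \<in> H \<Longrightarrow> \<tau> h \<in> H"
    and H_abelian: "h \<in> H \<Longrightarrow> h' \<in> H \<Longrightarrow> bracket h h' = 0"
    and H_self_centralizing: "(\<And>h. h \<in> H \<Longrightarrow> bracket h x = 0) \<Longrightarrow> x \<in> H"
begin

sublocale finite_dimensional_vector_space scale "extend_basis {}"
  by (rule finite_dimensional_extend_basis[OF finite_dim])

section \<open>Orthogonality for the Hermitian form\<close>

lemma form_add_right: "form z (x + y) = form z x + form z y"
  using form_sym[of z "x + y"] form_sym[of z x] form_sym[of z y] by (simp add: form_add_left)

lemma form_scale_right: "form z (scale c x) = cnj c * form z x"
  using form_sym[of z "scale c x"] form_sym[of z x] by (simp add: form_scale_left)

lemma form_zero [simp]: "form 0 z = 0" "form z 0 = 0"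
  using form_scale_left[of 0 0 z] form_scale_right[of z 0 0] by simp_all

lemma subspace_orthogonal: "subspace {x. \<forall>s\<in>S. form x s = 0}"
  by (rule subspaceI) (auto simp: form_add_left form_scale_left)

lemma subspace_orthogonal_right: "subspace {x. form z x = 0}"
  by (rule subspaceI) (auto simp: form_add_right form_scale_right)

text \<open>Gram-Schmidt: the new generator \<open>a\<close> is replaced by its component
  \<open>b\<close> orthogonal to the old span, and the projection of \<open>v\<close> is enlarged by
  a multiple of \<open>b\<close>.\<close>

lemma orthogonal_projection:
  assumes "finite S"
  shows "\<exists>w\<in>span S. \<forall>s\<in>span S. form (v - w) s = 0"
  using assms
proof (induction S arbitrary: v rule: finite_induct)
  case empty
  then show ?case by auto
next
  case (insert a S)
  obtain p where p: "p \<in> span S" "\<forall>s\<in>span S. form (a - p) s = 0" using insert.IH by blast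
  obtain w where w: "w \<in> span S" "\<forall>s\<in>span S. form (v - w) s = 0" using insert.IH by blast
  define b where "b = a - p"
  \<comment> \<open>The value 0 covers the case that \<open>a\<close> already lies in the old
    span.\<close>
  define c where "c = (if b = 0 then 0 else form (v - w) b / form b b)"
  have sub: "span S \<subseteq> span (insert a S)" by (rule span_mono) auto
  have b: "b \<in> span (insert a S)"
    unfolding b_def using sub p(1) by (intro span_diff) (auto intro: span_base)
  have fb: "form b b \<noteq> 0" if "b \<noteq> 0" using form_definite that by blast
  have diff: "v - (w + scale c b) = (v - w) + scale (- c) b" by simp
  have orth: "form (v - (w + scale c b)) s = form (v - w) s - c * form b s" for s
    unfolding diff form_add_left form_scale_left by simp
  have S: "form (v - (w + scale c b)) s = 0" if "s \<in> span S" for s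
    using w(2) p(2) that unfolding orth by (simp add: b_def)
  have "form (v - (w + scale c b)) b = 0" unfolding orth using fb by (auto simp: c_def)
  moreover have "a = b + p" by (simp add: b_def)
  ultimately have a: "form (v - (w + scale c b)) a = 0" using S[OF p(1)] by (simp add: form_add_right)
  have "span (insert a S) \<subseteq> {s. form (v - (w + scale c b)) s = 0}"
    by (rule span_minimal) (use a S span_base subspace_orthogonal_right in auto)
  then show ?case using b sub w(1) by (intro bexI[of _ "w + scale c b"]) (auto intro!: span_add span_scale)
qed

text \<open>The weight \<mu> is an arbitrary function of which only the values on \<open>H\<close>
  matter, so simultaneous eigenvectors can be found before linearity of the weight is known.\<close>

definition weight_space :: "('v \<Rightarrow> complex) \<Rightarrow> 'v set" where
  "weight_space \<mu> = {X. \<forall>h\<in>H. bracket h X = scale (\<mu> h) X}"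

lemma subspace_weight_space: "subspace (weight_space \<mu>)"
  by (rule subspaceI)
    (auto simp: weight_space_def bracket_linear_simps scale_right_distrib mult.commute)

text \<open>Induction on the dimension of \<open>M\<close>. If all of \<open>H\<close> acts by
  scalars, any nonzero vector works. Otherwise some \<open>h\<close> has an eigenspace that is
  nonzero and proper in \<open>M\<close>, and it is stable under \<open>H\<close> because
  \<open>H\<close> is abelian.\<close>

lemma common_eigenvector:
  assumes "subspace M" "M \<noteq> {0}" "\<And>h x. h \<in> H \<Longrightarrow> x \<in> M \<Longrightarrow> bracket h x \<in> M"
  shows "\<exists>X\<in>M. \<exists>\<mu>. X \<noteq> 0 \<and> X \<in> weight_space \<mu>"
  using assms
proof (induction "dim M" arbitrary: M rule: less_induct)
  case less
  show ?case
  proof (cases "\<forall>h\<in>H. \<exists>c. \<forall>x\<in>M. bracket h x = scale c x")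
    case True
    then obtain \<mu> where "\<And>h x. h \<in> H \<Longrightarrow> x \<in> M \<Longrightarrow> bracket h x = scale (\<mu> h) x" by metis
    moreover obtain x where "x \<in> M" "x \<noteq> 0" using less.prems subspace_0 by blast
    ultimately show ?thesis by (auto simp: weight_space_def)
  next
    case False
    then obtain h where h: "h \<in> H" "\<And>c. \<exists>x\<in>M. bracket h x \<noteq> scale c x" by blast
    obtain v c where v: "v \<in> M" "v \<noteq> 0" "bracket h v = scale c v"
      using exists_eigenvector_complex[OF finite_dimensional_vector_space_axioms bracket_linear_right[of h]
          less.prems(1) _ less.prems(2)] less.prems(3) h(1) by blast
    define M' where "M' = {x \<in> M. bracket h x = scale c x}"
    have sub: "subspace M'"
      using less.prems(1) by (auto simp: M'_def subspace_def bracket_linear_simps scale_right_distrib mult.commute)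
    have "M' \<subset> M" using h(2)[of c] by (auto simp: M'_def)
    moreover have "span M' = M'" "span M = M" using sub less.prems(1) by (simp_all add: span_eq_iff)
    ultimately have "dim M' < dim M" by (intro dim_psubset) metis
    moreover have "bracket h' x \<in> M'" if "h' \<in> H" "x \<in> M'" for h' x
      using that less.prems(3) bracket_derivation[of h h' x] H_abelian[OF h(1) that(1)]
      by (simp add: M'_def bracket_linear_simps)
    moreover have "M' \<noteq> {0}" using v by (auto simp: M'_def)
    ultimately obtain X \<mu> where "X \<in> M'" "X \<noteq> 0" "X \<in> weight_space \<mu>"
      using less.hyps[OF _ sub] by blast
    then show ?thesis by (auto simp: M'_def)
  qed
qed

text \<open>The span \<open>W\<close> of all weight vectors is stable under \<open>H\<close>, hence
  so is its orthogonal complement, because ad h has adjoint - ad (\<tau> h) with \<tau> h again in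
  \<open>H\<close>. A nonzero complement would contain a weight vector, which would be orthogonal to
  itself.\<close>

lemma span_weight_spaces: "span (\<Union>\<mu>. weight_space \<mu>) = UNIV"
proof (rule ccontr)
  define W where "W = (\<Union>\<mu>. weight_space \<mu>)"
  assume "span (\<Union>\<mu>. weight_space \<mu>) \<noteq> UNIV"
  then obtain v where v: "v \<notin> span W" by (auto simp: W_def)
  obtain S where S: "S \<subseteq> W" "independent S" "W \<subseteq> span S" by (metis basis_exists)
  have "span S = span W" using S span_mono[OF S(1)] span_minimal[OF S(3) subspace_span] by auto
  with orthogonal_projection[OF finiteI_independent[OF S(2)], of v]
  obtain w where w: "w \<in> span W" "\<forall>s\<in>span W. form (v - w) s = 0" by auto
  define M where "M = {x. \<forall>s\<in>span W. form x s = 0}"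
  have W_inv: "bracket h s \<in> span W" if "h \<in> H" "s \<in> span W" for h s
    using that(2)
  proof (induction rule: span_induct_alt)
    case (step c x y)
    then obtain \<mu> where "x \<in> weight_space \<mu>" by (auto simp: W_def)
    then have "bracket h x = scale (\<mu> h) x" using that(1) by (simp add: weight_space_def)
    then show ?case using step by (simp add: bracket_linear_simps span_add span_scale span_base)
  qed (simp add: bracket_linear_simps span_zero)
  have "\<exists>X\<in>M. \<exists>\<mu>. X \<noteq> 0 \<and> X \<in> weight_space \<mu>"
  proof (rule common_eigenvector)
    show "subspace M" unfolding M_def by (rule subspace_orthogonal)
    have "v - w \<in> M" "v - w \<noteq> 0" using w v by (auto simp: M_def)
    then show "M \<noteq> {0}" by blast
    show "bracket h x \<in> M" if "h \<in> H" "x \<in> M" for h x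
      using that W_inv tau_H by (auto simp: M_def form_bracket)
  qed
  then obtain X where "X \<in> M" "X \<in> W" "X \<noteq> 0" by (auto simp: W_def)
  then show False using form_definite span_base by (auto simp: M_def)
qed

section \<open>Weights, roots and root vectors\<close>

lemma weight_space_zero: "weight_space (\<lambda>_. 0) = H"
  using H_self_centralizing H_abelian by (auto simp: weight_space_def)

lemma weight_space_cong: "(\<And>h. h \<in> H \<Longrightarrow> \<mu> h = \<nu> h) \<Longrightarrow> weight_space \<mu> = weight_space \<nu>"
  by (auto simp: weight_space_def)

text \<open>The eigenvalue on a fixed nonzero vector inherits linearity from the bracket; cutting it
  off outside \<open>H\<close> gives the representative that \<open>dual_on\<close>
  prescribes.\<close>

lemma rootI:
  assumes "X \<in> weight_space \<mu>" "X \<noteq> 0" "h \<in> H" "\<mu> h \<noteq> 0"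
  shows "(\<lambda>x. if x \<in> H then \<mu> x else 0) \<in> roots H"
proof -
  have X: "bracket x X = scale (\<mu> x) X" if "x \<in> H" for x
    using assms(1) that by (simp add: weight_space_def)
  have "\<mu> (x + y) = \<mu> x + \<mu> y" if "x \<in> H" "y \<in> H" for x y
  proof -
    have "scale (\<mu> (x + y)) X = scale (\<mu> x + \<mu> y) X"
      using bracket_add_left[of x y X] unfolding X[OF that(1)] X[OF that(2)]
        X[OF subspace_add[OF subspace_H that]] scale_left_distrib .
    then show ?thesis using assms(2) by simp
  qed
  moreover have "\<mu> (scale c x) = c * \<mu> x" if "x \<in> H" for x c
  proof -
    have "scale (\<mu> (scale c x)) X = scale (c * \<mu> x) X"
      using bracket_scale_left[of c x X] unfolding X[OF that]
        X[OF subspace_scale[OF subspace_H that]] scale_scale .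
    then show ?thesis using assms(2) by simp
  qed
  ultimately have "(\<lambda>x. if x \<in> H then \<mu> x else 0) \<in> dual_on H"
    by (auto simp: dual_on_def subspace_add[OF subspace_H] subspace_scale[OF subspace_H])
  then show ?thesis using assms by (auto simp: roots_def weight_space_def)
qed

lemma weight_cases:
  assumes "X \<in> weight_space \<mu>" "X \<noteq> 0"
  obtains "\<And>h. h \<in> H \<Longrightarrow> \<mu> h = 0"
  | \<beta> where "\<beta> \<in> roots H" "\<And>h. h \<in> H \<Longrightarrow> \<beta> h = \<mu> h"
proof (cases "\<forall>h\<in>H. \<mu> h = 0")
  case True
  then show ?thesis using that(1) by blast
next
  case False
  then show ?thesis using rootI[OF assms] that(2) by force
qed

lemma root_vector:
  assumes "\<beta> \<in> roots H"
  obtains X where "X \<in> weight_space \<beta>" "X \<noteq> 0"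
  using assms by (auto simp: roots_def weight_space_def)

lemma root_eqI:
  assumes "\<beta> \<in> roots H" "\<gamma> \<in> roots H" "\<And>h. h \<in> H \<Longrightarrow> \<beta> h = \<gamma> h"
  shows "\<beta> = \<gamma>"
proof
  fix x show "\<beta> x = \<gamma> x"
    using assms by (cases "x \<in> H") (auto simp: roots_def dual_on_def)
qed

text \<open>The root space decomposition as an induction rule. Scalar multiples need no case of
  their own, as the cases for \<open>H\<close> and for root vectors range over whole
  subspaces.\<close>

lemma root_decomposition_induct [case_names add cartan root]:
  assumes "\<And>x y. P x \<Longrightarrow> P y \<Longrightarrow> P (x + y)"
    and "\<And>h. h \<in> H \<Longrightarrow> P h"
    and "\<And>\<beta> X. \<beta> \<in> roots H \<Longrightarrow> X \<in> weight_space \<beta> \<Longrightarrow> P X"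
  shows "P v"
proof -
  have "v \<in> span (\<Union>\<mu>. weight_space \<mu>)" using span_weight_spaces by simp
  then show ?thesis
  proof (induction rule: span_induct_alt)
    case base
    then show ?case using assms(2) subspace_0[OF subspace_H] by blast
  next
    case (step c x y)
    then obtain \<mu> where "x \<in> weight_space \<mu>" by auto
    then have x: "scale c x \<in> weight_space \<mu>" using subspace_scale[OF subspace_weight_space] by blast
    have "P (scale c x)"
    proof (cases "scale c x = 0")
      case True
      then show ?thesis using assms(2) subspace_0[OF subspace_H] by metis
    next
      case False
      from x this show ?thesis
      proof (cases rule: weight_cases)
        case 1
        then show ?thesis using x weight_space_cong[of \<mu> "\<lambda>_. 0"] assms(2) by (auto simp: weight_space_zero)
      next
        case (2 \<beta>)
        then show ?thesis using x weight_space_cong[of \<mu> \<beta>] assms(3) by auto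
      qed
    qed
    then show ?case using assms(1) step by blast
  qed
qed

lemma weight_space_bracket:
  assumes "X \<in> weight_space \<mu>" "Y \<in> weight_space \<nu>"
  shows "bracket X Y \<in> weight_space (\<lambda>h. \<mu> h + \<nu> h)"
  using assms by (auto simp: weight_space_def bracket_derivation[of _ X Y] bracket_linear_simps scale_left_distrib)

text \<open>Evaluate \<open>form (bracket h X) X\<close> in two ways and cancel
  \<open>form X X\<close>. In particular a weight is purely imaginary on the fixed points of \<tau>
  in \<open>H\<close>.\<close>

lemma weight_tau:
  assumes "X \<in> weight_space \<mu>" "X \<noteq> 0" "h \<in> H"
  shows "cnj (\<mu> (\<tau> h)) = - \<mu> h"
proof -
  have "\<mu> h * form X X = form (bracket h X) X"
    using assms by (simp add: weight_space_def form_scale_left)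
  also have "\<dots> = - form X (bracket (\<tau> h) X)" by (rule form_bracket)
  also have "\<dots> = - cnj (\<mu> (\<tau> h)) * form X X"
    using assms tau_H by (simp add: weight_space_def form_scale_right)
  finally have "(\<mu> h + cnj (\<mu> (\<tau> h))) * form X X = 0" by (simp add: algebra_simps)
  then show ?thesis using form_definite assms(2) by (auto simp: eq_neg_iff_add_eq_0 add.commute)
qed

lemma tau_weight_space:
  assumes "X \<in> weight_space \<mu>"
  shows "\<tau> X \<in> weight_space (\<lambda>h. - \<mu> h)"
proof (cases "X = 0")
  case True
  then have "\<tau> X = 0" using tau_scale[of 0 0] by simp
  then show ?thesis using subspace_0[OF subspace_weight_space] by metis
next
  case False
  have "bracket h (\<tau> X) = scale (- \<mu> h) (\<tau> X)" if "h \<in> H" for h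
  proof -
    have "bracket h (\<tau> X) = \<tau> (bracket (\<tau> h) X)" by (simp add: tau_bracket tau_tau)
    also have "\<dots> = scale (cnj (\<mu> (\<tau> h))) (\<tau> X)"
      using assms tau_H[OF that] by (simp add: weight_space_def tau_scale)
    finally show ?thesis using weight_tau[OF assms False that] by simp
  qed
  then show ?thesis by (simp add: weight_space_def)
qed

lemma tau_eq_0_iff: "\<tau> X = 0 \<longleftrightarrow> X = 0"
  using tau_scale[of 0 0] tau_tau[of X] by auto

lemma neg_root:
  assumes "\<beta> \<in> roots H"
  shows "(\<lambda>h. - \<beta> h) \<in> roots H"
proof -
  obtain X where X: "X \<in> weight_space \<beta>" "X \<noteq> 0" using assms by (rule root_vector)
  obtain h where h: "h \<in> H" "\<beta> h \<noteq> 0" using assms by (auto simp: roots_def)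
  have "(\<lambda>x. if x \<in> H then - \<beta> x else 0) \<in> roots H"
    using rootI[OF tau_weight_space[OF X(1)], of h] X(2) h by (simp add: tau_eq_0_iff)
  moreover have "(\<lambda>x. if x \<in> H then - \<beta> x else 0) = (\<lambda>h. - \<beta> h)"
    using assms by (auto simp: roots_def dual_on_def)
  ultimately show ?thesis by simp
qed

text \<open>The usual argument for normal operators: \<open>Y\<close> is also an eigenvector of the
  adjoint of ad h, for the conjugate eigenvalue. The case \<open>Y = 0\<close> is separate because
  \<open>weight_tau\<close> needs a nonzero vector.\<close>

lemma weight_spaces_orthogonal:
  assumes "X \<in> weight_space \<mu>" "Y \<in> weight_space \<nu>" "h \<in> H" "\<mu> h \<noteq> \<nu> h"
  shows "form X Y = 0"
proof (cases "Y = 0")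
  case False
  have "\<mu> h * form X Y = form (bracket h X) Y"
    using assms by (simp add: weight_space_def form_scale_left)
  also have "\<dots> = - form X (bracket (\<tau> h) Y)" by (rule form_bracket)
  also have "\<dots> = - cnj (\<nu> (\<tau> h)) * form X Y"
    using assms tau_H by (simp add: weight_space_def form_scale_right)
  finally show ?thesis using weight_tau[OF assms(2) False assms(3)] assms(4) by simp
qed simp

text \<open>Choosing one nonzero vector per root gives an orthogonal, hence independent, family.
  Finiteness makes the maximum of the heights meaningful.\<close>

lemma finite_roots: "finite (roots H)"
proof -
  have "\<exists>X. X \<in> weight_space \<beta> \<and> X \<noteq> 0" if "\<beta> \<in> roots H" for \<beta> using that root_vector by blast
  then obtain X where X: "\<And>\<beta>. \<beta> \<in> roots H \<Longrightarrow> X \<beta> \<in> weight_space \<beta> \<and> X \<beta> \<noteq> 0" by metis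
  have orth: "form (X \<gamma>) (X \<beta>) = 0" if "\<beta> \<in> roots H" "\<gamma> \<in> roots H" "\<gamma> \<noteq> \<beta>" for \<beta> \<gamma>
    using weight_spaces_orthogonal[of "X \<gamma>" \<gamma> "X \<beta>" \<beta>] X root_eqI[OF that(2,1)] that by blast
  have inj: "inj_on X (roots H)" using orth X form_definite by (metis inj_onI)
  have "independent (X ` roots H)"
  proof
    assume "dependent (X ` roots H)"
    then obtain \<beta> where \<beta>: "\<beta> \<in> roots H" "X \<beta> \<in> span (X ` roots H - {X \<beta>})"
      by (auto simp: dependent_def)
    have "span (X ` roots H - {X \<beta>}) \<subseteq> {x. \<forall>s\<in>{X \<beta>}. form x s = 0}"
      by (rule span_minimal[OF _ subspace_orthogonal]) (use orth \<beta> in auto)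
    then show False using \<beta> X form_definite by auto
  qed
  then show ?thesis using finiteI_independent finite_image_iff[OF inj] by blast
qed

lemma roots_nonempty: "roots H \<noteq> {}"
proof
  assume "roots H = {}"
  have "v \<in> H" for v
    by (induction v rule: root_decomposition_induct)
      (use \<open>roots H = {}\<close> subspace_add[OF subspace_H] in auto)
  then show False using is_simple H_abelian by (auto simp: simple_def)
qed

text \<open>An element of \<open>H\<close> on which all roots vanish is central, and the center is
  an ideal different from the whole nonabelian simple algebra.\<close>

lemma roots_separate:
  assumes "h \<in> H" "\<And>\<beta>. \<beta> \<in> roots H \<Longrightarrow> \<beta> h = 0"
  shows "h = 0"
proof -
  have "bracket h v = 0" for v
    by (induction v rule: root_decomposition_induct)
      (use assms H_abelian in \<open>auto simp: bracket_add_right weight_space_def\<close>)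
  then have h: "bracket v h = 0" for v using bracket_antisym[of v h] by simp
  have "lie_ideal {x. \<forall>y. bracket y x = 0}"
    by (auto simp: lie_ideal_def subspace_def bracket_linear_simps)
  then have "{x. \<forall>y. bracket y x = 0} = {0}"
    using is_simple unfolding simple_def by blast
  then show ?thesis using h by blast
qed

end

section \<open>Heights and the lowest root\<close>

locale hermitian_cartan_base = hermitian_cartan +
  fixes N :: nat and \<alpha> :: "nat \<Rightarrow> 'a \<Rightarrow> complex"
  assumes base: "simple_roots H N \<alpha>"
begin

lemma simple_root: "i \<in> {1..N} \<Longrightarrow> \<alpha> i \<in> roots H"
  using base by (auto simp: simple_roots_def)

text \<open>Shows that the description in \<open>dual_basis\<close> determines a vector: existence
  follows from independence of the simple roots, uniqueness from \<open>roots_separate\<close>,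
  since all roots are combinations of simple ones.\<close>

lemma dual_basis:
  assumes "j \<in> {1..N}"
  shows dual_basis_in: "dual_basis H N \<alpha> j \<in> H"
    and dual_basis_eq: "i \<in> {1..N} \<Longrightarrow> \<alpha> i (dual_basis H N \<alpha> j) = (if i = j then 1 else 0)"
proof -
  have "\<exists>e. \<forall>j\<in>{1..N}. e j \<in> H \<and> (\<forall>i\<in>{1..N}. \<alpha> i (e j) = (if i = j then 1 else 0))"
    by (rule independent_dual_family[OF _ subspace_H])
      (use base in \<open>auto simp: simple_roots_def roots_def dual_on_def\<close>)
  then obtain e where e: "e \<in> H" "\<forall>i\<in>{1..N}. \<alpha> i e = (if i = j then 1 else 0)" using assms by blast
  have uniq: "e' = e" if e': "e' \<in> H" "\<forall>i\<in>{1..N}. \<alpha> i e' = (if i = j then 1 else 0)" for e'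
  proof -
    have "e' - e = 0"
    proof (rule roots_separate)
      show "e' - e \<in> H" using e(1) e'(1) subspace_diff[OF subspace_H] by blast
      fix \<beta> assume \<beta>: "\<beta> \<in> roots H"
      then have "\<beta> (e' - e) = \<beta> e' - \<beta> e"
        using e(1) e'(1) subspace_diff[OF subspace_H, of e' e]
        by (auto simp: roots_def dual_on_def) (metis diff_add_cancel add_diff_cancel)
      moreover obtain n :: "nat \<Rightarrow> int" where "\<And>x. \<beta> x = (\<Sum>i=1..N. of_int (n i) * \<alpha> i x)"
        using base \<beta> by (auto simp: simple_roots_def)
      ultimately show "\<beta> (e' - e) = 0" using e(2) e'(2) by simp
    qed
    then show ?thesis by simp
  qed
  have "dual_basis H N \<alpha> j \<in> H \<and> (\<forall>i\<in>{1..N}. \<alpha> i (dual_basis H N \<alpha> j) = (if i = j then 1 else 0))"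
    unfolding dual_basis_def by (rule theI[of _ e]) (use e uniq in blast)+
  then show "dual_basis H N \<alpha> j \<in> H"
    "i \<in> {1..N} \<Longrightarrow> \<alpha> i (dual_basis H N \<alpha> j) = (if i = j then 1 else 0)" by auto
qed

text \<open>The sum of the fundamental coweights. Evaluation at this element turns a root into its
  height.\<close>

definition rho :: 'a where "rho = (\<Sum>j=1..N. dual_basis H N \<alpha> j)"

lemma rho_in: "rho \<in> H"
  unfolding rho_def using dual_basis_in by (intro subspace_sum[OF subspace_H]) auto

lemma simple_root_rho:
  assumes "i \<in> {1..N}"
  shows "\<alpha> i rho = 1"
proof -
  have "\<alpha> i (\<Sum>j\<in>J. dual_basis H N \<alpha> j) = (\<Sum>j\<in>J. \<alpha> i (dual_basis H N \<alpha> j))"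
    if "finite J" "J \<subseteq> {1..N}" for J
    using that
  proof (induction J rule: finite_induct)
    case empty
    have "\<alpha> i (scale 0 0) = 0 * \<alpha> i 0"
      using simple_root[OF assms] subspace_0[OF subspace_H] unfolding roots_def dual_on_def by blast
    then show ?case by simp
  next
    case (insert j J)
    then have "dual_basis H N \<alpha> j \<in> H" "(\<Sum>j\<in>J. dual_basis H N \<alpha> j) \<in> H"
      using dual_basis_in by (auto intro!: subspace_sum[OF subspace_H])
    then show ?case using insert simple_root[OF assms] by (auto simp: roots_def dual_on_def)
  qed
  from this[of "{1..N}"] have "\<alpha> i rho = (\<Sum>j=1..N. if i = j then 1 else 0)"
    unfolding rho_def using dual_basis_eq[OF _ assms] by simp
  also have "\<dots> = 1" using assms by simp
  finally show ?thesis .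
qed

text \<open>Evaluation at \<open>rho\<close> recovers the coefficient sum, so it does not depend on
  the chosen expansion.\<close>

lemma height_eqI:
  assumes "\<And>x. \<beta> x = (\<Sum>i=1..N. of_int (n i) * \<alpha> i x)"
  shows "height N \<alpha> \<beta> = (\<Sum>i=1..N. n i)"
  unfolding height_def
proof (rule the_equality)
  fix m assume "\<exists>n. (\<forall>x. \<beta> x = (\<Sum>i=1..N. of_int (n i) * \<alpha> i x)) \<and> m = sum n {1..N}"
  then obtain n' :: "nat \<Rightarrow> int" where n': "\<And>x. \<beta> x = (\<Sum>i=1..N. of_int (n' i) * \<alpha> i x)" "m = sum n' {1..N}"
    by blast
  have "of_int m = (of_int (\<Sum>i=1..N. n i) :: complex)"
    using n'(1)[of rho] assms[of rho] simple_root_rho by (simp add: n'(2))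
  then show "m = (\<Sum>i=1..N. n i)" by (simp only: of_int_eq_iff)
qed (use assms in blast)

lemma root_rho:
  assumes "\<beta> \<in> roots H"
  shows "\<beta> rho = of_int (height N \<alpha> \<beta>)"
proof -
  obtain n :: "nat \<Rightarrow> int" where n: "\<And>x. \<beta> x = (\<Sum>i=1..N. of_int (n i) * \<alpha> i x)"
    using base assms by (auto simp: simple_roots_def)
  show ?thesis unfolding height_eqI[of \<beta> n, OF n] using n[of rho] simple_root_rho by simp
qed

lemma height_neg: "\<beta> \<in> roots H \<Longrightarrow> height N \<alpha> (\<lambda>h. - \<beta> h) = - height N \<alpha> \<beta>"
  using root_rho[of \<beta>] root_rho[OF neg_root[of \<beta>]] by (metis of_int_eq_iff of_int_minus)

lemma height_simple: "i \<in> {1..N} \<Longrightarrow> height N \<alpha> (\<alpha> i) = 1"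
  using root_rho[OF simple_root] simple_root_rho by (metis of_int_eq_1_iff)

text \<open>The coefficients of a root have one sign, so a vanishing sum would make all of them
  zero.\<close>

lemma height_nonzero:
  assumes "\<beta> \<in> roots H"
  shows "height N \<alpha> \<beta> \<noteq> 0"
proof
  assume 0: "height N \<alpha> \<beta> = 0"
  obtain n :: "nat \<Rightarrow> int" where n: "\<And>x. \<beta> x = (\<Sum>i=1..N. of_int (n i) * \<alpha> i x)"
      "(\<forall>i\<in>{1..N}. 0 \<le> n i) \<or> (\<forall>i\<in>{1..N}. n i \<le> 0)"
    using base assms unfolding simple_roots_def by blast
  have "(\<Sum>i=1..N. n i) = 0" using height_eqI[of \<beta> n, OF n(1)] 0 by simp
  then have s: "sum n {1..N} = 0" "sum (\<lambda>i. - n i) {1..N} = 0" by (simp_all add: sum_negf)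
  from n(2) have "\<forall>i\<in>{1..N}. n i = 0"
  proof
    assume "\<forall>i\<in>{1..N}. 0 \<le> n i"
    then show ?thesis using s(1) by (subst (asm) sum_nonneg_eq_0_iff) auto
  next
    assume "\<forall>i\<in>{1..N}. n i \<le> 0"
    then show ?thesis using s(2) by (subst (asm) sum_nonneg_eq_0_iff) auto
  qed
  then have "\<beta> x = 0" for x by (simp add: n(1))
  then show False using assms by (auto simp: roots_def)
qed

text \<open>Sum 1 rules out nonpositive coefficients, and nonnegative integers with sum 1 are a
  single 1 and zeros.\<close>

lemma height_one_simple:
  assumes "\<beta> \<in> roots H" "height N \<alpha> \<beta> = 1"
  shows "\<beta> \<in> \<alpha> ` {1..N}"
proof -
  obtain n :: "nat \<Rightarrow> int" where n: "\<And>x. \<beta> x = (\<Sum>i=1..N. of_int (n i) * \<alpha> i x)"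
      "(\<forall>i\<in>{1..N}. 0 \<le> n i) \<or> (\<forall>i\<in>{1..N}. n i \<le> 0)"
    using base assms unfolding simple_roots_def by blast
  have s: "(\<Sum>i=1..N. n i) = 1" using height_eqI[of \<beta> n, OF n(1)] assms by simp
  have nonneg: "\<forall>i\<in>{1..N}. 0 \<le> n i" using n(2) s sum_nonpos[of "{1..N}" n] by auto
  obtain i where i: "i \<in> {1..N}" "n i \<noteq> 0" using s by (metis sum.neutral zero_neq_one)
  have "(\<Sum>j=1..N. n j) = n i + sum n ({1..N} - {i})" using i(1) by (simp add: sum.remove)
  moreover have rest: "0 \<le> sum n ({1..N} - {i})" using nonneg by (intro sum_nonneg) auto
  ultimately have ni: "n i = 1" "sum n ({1..N} - {i}) = 0"
    using s i nonneg by (smt (verit) DiffD1)+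
  then have "\<forall>j\<in>{1..N} - {i}. n j = 0"
    using nonneg sum_nonneg_eq_0_iff[of "{1..N} - {i}" n] by auto
  then have "\<beta> x = \<alpha> i x" for x
    unfolding n(1) using i(1) ni(1) by (subst sum.remove[of _ i]) auto
  then have "\<beta> = \<alpha> i" by (rule ext)
  then show ?thesis using i(1) by blast
qed

section \<open>Maximal height and the extremal roots\<close>

definition max_height :: int where "max_height = Max (height N \<alpha> ` roots H)"

lemma coxeter_number_eq: "coxeter_number H N \<alpha> = max_height + 1"
  by (simp add: coxeter_number_def max_height_def)

lemma height_le_max: "\<beta> \<in> roots H \<Longrightarrow> height N \<alpha> \<beta> \<le> max_height"
  unfolding max_height_def using finite_roots by (intro Max_ge) auto

lemma height_ge_min: "\<beta> \<in> roots H \<Longrightarrow> - max_height \<le> height N \<alpha> \<beta>"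
  using height_le_max[OF neg_root] height_neg by fastforce

lemma max_height_attained: "\<exists>\<beta>\<in>roots H. height N \<alpha> \<beta> = max_height"
proof -
  have "Max (height N \<alpha> ` roots H) \<in> height N \<alpha> ` roots H"
    by (rule Max_in) (use finite_roots roots_nonempty in auto)
  then show ?thesis unfolding max_height_def by force
qed

lemma max_height_pos: "0 < max_height"
  using roots_nonempty height_nonzero height_le_max height_ge_min by fastforce

text \<open>Such a weight is neither a root nor zero on \<open>H\<close>; the latter because
  \<open>m\<close> exceeds the positive number \<open>max_height\<close>.\<close>

lemma above_max_height:
  assumes "X \<in> weight_space \<mu>" "\<mu> rho = of_int m" "max_height < m"
  shows "X = 0"
proof (rule ccontr)
  assume "X \<noteq> 0"
  with assms(1) show False
  proof (cases rule: weight_cases)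
    case 1
    then show ?thesis using assms rho_in max_height_pos by simp
  next
    case (2 \<beta>)
    then have "of_int (height N \<alpha> \<beta>) = (of_int m :: complex)" using root_rho rho_in assms(2) by metis
    then show ?thesis using height_le_max[OF 2(1)] assms(3) by simp
  qed
qed

text \<open>The ideal generated by a vector \<open>X\<close> of maximal height is spanned by \<open>X\<close> and brackets
  with negative root vectors, and both are orthogonal to any other root space of maximal height.\<close>

lemma highest_root_unique:
  assumes \<beta>: "\<beta> \<in> roots H" "height N \<alpha> \<beta> = max_height"
    and \<gamma>: "\<gamma> \<in> roots H" "height N \<alpha> \<gamma> = max_height"
  shows "\<beta> = \<gamma>"
proof (rule ccontr)
  assume "\<beta> \<noteq> \<gamma>"
  then obtain h where h: "h \<in> H" "\<beta> h \<noteq> \<gamma> h" using root_eqI \<beta> \<gamma> by blast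
  obtain X where X: "X \<in> weight_space \<beta>" "X \<noteq> 0" using \<beta>(1) by (rule root_vector)
  obtain Y where Y: "Y \<in> weight_space \<gamma>" "Y \<noteq> 0" using \<gamma>(1) by (rule root_vector)
  \<comment> \<open>\<open>U\<close> will be the least subspace that contains \<open>X\<close> and
    is stable under root vectors of negative height. It is shown to be an ideal.\<close>
  define closed where "closed S \<longleftrightarrow> subspace S \<and> X \<in> S \<and>
    (\<forall>\<delta>\<in>roots H. height N \<alpha> \<delta> < 0 \<longrightarrow> (\<forall>y\<in>weight_space \<delta>. \<forall>v\<in>S. bracket y v \<in> S))" for S
  define U where "U = \<Inter>{S. closed S}"
  have U: "closed U" unfolding closed_def U_def by (auto simp: subspace_Inter)
  have U_min: "U \<subseteq> S" if "closed S" for S using that by (auto simp: U_def)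
  have U_sub: "subspace U" using U by (simp add: closed_def)
  \<comment> \<open>By minimality of \<open>U\<close> this puts every bracket with an element of
    \<open>U\<close> back into \<open>U\<close>. On \<open>X\<close> itself, positive root vectors
    give 0 and \<open>H\<close> acts by scalars; the derivation rule passes the property on to
    \<open>bracket y v\<close>.\<close>
  have "closed {v \<in> U. \<forall>z. bracket z v \<in> U}"
    unfolding closed_def
  proof (intro conjI ballI impI)
    show "subspace {v \<in> U. \<forall>z. bracket z v \<in> U}"
      using U_sub by (auto simp: subspace_def bracket_linear_simps)
    have "bracket z X \<in> U" for z
    proof (induction z rule: root_decomposition_induct)
      case (add x y)
      then show ?case using U_sub by (simp add: bracket_add_left subspace_add)
    next
      case (cartan h)
      then show ?case using X(1) U U_sub by (auto simp: weight_space_def closed_def subspace_scale)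
    next
      case (root \<delta> z)
      show ?case
      proof (cases "height N \<alpha> \<delta> < 0")
        case True
        then show ?thesis using U root by (auto simp: closed_def)
      next
        case False
        then have "0 < height N \<alpha> \<delta>" using height_nonzero[OF root(1)] by simp
        then have "bracket z X = 0"
          using above_max_height[OF weight_space_bracket[OF root(2) X(1)], of "height N \<alpha> \<delta> + max_height"]
            root_rho[OF root(1)] root_rho[OF \<beta>(1)] \<beta>(2) by simp
        then show ?thesis using subspace_0[OF U_sub] by simp
      qed
    qed
    then show "X \<in> {v \<in> U. \<forall>z. bracket z v \<in> U}" using U by (auto simp: closed_def)
    fix \<delta> y v assume "\<delta> \<in> roots H" "height N \<alpha> \<delta> < 0" and y: "y \<in> weight_space \<delta>"
      and v: "v \<in> {v \<in> U. \<forall>z. bracket z v \<in> U}"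
    then have yU: "bracket y w \<in> U" if "w \<in> U" for w using U that by (auto simp: closed_def)
    have "bracket z (bracket y v) \<in> U" for z
      unfolding bracket_derivation[of z y v] using v yU by (intro subspace_add[OF U_sub]) auto
    then show "bracket y v \<in> {v \<in> U. \<forall>z. bracket z v \<in> U}" using v by blast
  qed
  then have "lie_ideal U" using U_min U_sub by (fastforce simp: lie_ideal_def)
  moreover have "U \<noteq> {0}" using U X by (auto simp: closed_def)
  ultimately have "U = UNIV" using is_simple by (auto simp: simple_def)
  \<comment> \<open>Minimality of \<open>U\<close> is used a second time: the orthogonal complement
    of \<open>Y\<close> contains \<open>U\<close>, hence everything, including
    \<open>Y\<close>.\<close>
  have "closed {v. \<forall>s\<in>{Y}. form v s = 0}"
    unfolding closed_def
  proof (intro conjI ballI impI subspace_orthogonal)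
    show "X \<in> {v. \<forall>s\<in>{Y}. form v s = 0}" using weight_spaces_orthogonal[OF X(1) Y(1) h] by simp
    fix \<delta> y v assume \<delta>: "\<delta> \<in> roots H" "height N \<alpha> \<delta> < 0" "y \<in> weight_space \<delta>"
    \<comment> \<open>\<tau> y has weight -\<delta>, of positive height, so the bracket would lie
      above the maximal height.\<close>
    have "bracket (\<tau> y) Y = 0"
      using above_max_height[OF weight_space_bracket[OF tau_weight_space[OF \<delta>(3)] Y(1)],
          of "- height N \<alpha> \<delta> + max_height"] root_rho[OF \<delta>(1)] root_rho[OF \<gamma>(1)] \<gamma>(2) \<delta>(2) by simp
    then show "bracket y v \<in> {v. \<forall>s\<in>{Y}. form v s = 0}" by (simp add: form_bracket)
  qed
  then have "form Y Y = 0" using U_min \<open>U = UNIV\<close> by blast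
  then show False using form_definite Y(2) by blast
qed

lemma lowest_root_unique:
  assumes "\<beta> \<in> roots H" "height N \<alpha> \<beta> = - max_height"
    and "\<gamma> \<in> roots H" "height N \<alpha> \<gamma> = - max_height"
  shows "\<beta> = \<gamma>"
proof -
  have "(\<lambda>h. - \<beta> h) = (\<lambda>h. - \<gamma> h)"
    using assms by (intro highest_root_unique neg_root) (simp_all add: height_neg)
  then have "- \<beta> h = - \<gamma> h" for h by (rule fun_cong)
  then show ?thesis by auto
qed

lemma lowest_root:
  shows lowest_root_in: "lowest_root H N \<alpha> \<in> roots H"
    and height_lowest_root: "height N \<alpha> (lowest_root H N \<alpha>) = - max_height"
proof -
  obtain \<beta> where "\<beta> \<in> roots H" "height N \<alpha> \<beta> = max_height" using max_height_attained by blast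
  then have \<gamma>: "(\<lambda>h. - \<beta> h) \<in> roots H" "height N \<alpha> (\<lambda>h. - \<beta> h) = - max_height"
    using neg_root height_neg by auto
  have "lowest_root H N \<alpha> = (\<lambda>h. - \<beta> h)"
    unfolding lowest_root_def
  proof (rule the_equality)
    show "(\<lambda>h. - \<beta> h) \<in> roots H \<and> (\<forall>\<delta>\<in>roots H. height N \<alpha> (\<lambda>h. - \<beta> h) \<le> height N \<alpha> \<delta>)"
      using \<gamma> height_ge_min by auto
    fix \<delta> assume \<delta>: "\<delta> \<in> roots H \<and> (\<forall>\<gamma>\<in>roots H. height N \<alpha> \<delta> \<le> height N \<alpha> \<gamma>)"
    then have "height N \<alpha> \<delta> = - max_height" using \<gamma> height_ge_min by fastforce
    then show "\<delta> = (\<lambda>h. - \<beta> h)" using lowest_root_unique \<gamma> \<delta> by blast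
  qed
  then show "lowest_root H N \<alpha> \<in> roots H" "height N \<alpha> (lowest_root H N \<alpha>) = - max_height"
    using \<gamma> by auto
qed

end

section \<open>The Coxeter automorphism\<close>

text \<open>On an eigenvector each coordinate series is a multiple of the scalar exponential series.
  As eigenvectors span, the coordinate series of every vector converge, which is what allows the
  sums to be added for linearity.\<close>

lemma
  fixes scale :: "complex \<Rightarrow> 'v::ab_group_add \<Rightarrow> 'v"
  assumes "vector_space scale"
    and fin: "\<exists>B. finite B \<and> module.span scale B = UNIV"
    and A: "Vector_Spaces.linear scale scale A"
    and diag: "module.span scale {v. \<exists>c. A v = scale c v} = UNIV"
  shows endo_exp_linear: "Vector_Spaces.linear scale scale (endo_exp scale A)"
    and endo_exp_eigenvector: "A v = scale c v \<Longrightarrow> endo_exp scale A v = scale (exp c) v"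
proof -
  interpret vector_space scale by fact
  interpret A: Vector_Spaces.linear scale scale A by fact
  define B where "B = extend_basis {}"
  define r where "r = representation B"
  have B: "independent B" "span B = UNIV" "finite B"
    using independent_extend_basis[OF independent_empty] span_extend_basis[OF independent_empty]
      finite_extend_basis_empty[OF fin] by (simp_all add: B_def)
  have r: "r (x + y) b = r x b + r y b" "r (scale a x) b = a * r x b" for x y a b
    using B by (simp_all add: r_def representation_add representation_scale)
  have add: "(A ^^ n) (x + y) = (A ^^ n) x + (A ^^ n) y" for n x y
    by (induction n) (simp_all add: A.add)
  have scl: "(A ^^ n) (scale a x) = scale a ((A ^^ n) x)" for n a x
    by (induction n) (simp_all add: A.scale)
  have eig: "(A ^^ n) v = scale (c ^ n) v" if "A v = scale c v" for n v c
    by (induction n) (simp_all add: that A.scale mult.commute)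
  define T where "T v b n = r ((A ^^ n) v) b / fact n" for v b n
  have T: "T (x + y) b = (\<lambda>n. T x b n + T y b n)" "T (scale a x) b = (\<lambda>n. a * T x b n)" for x y a b
    by (simp_all add: T_def fun_eq_iff add scl r add_divide_distrib)
  have T_eig: "T v b sums (exp c * r v b)" if "A v = scale c v" for v c b
  proof -
    have "(\<lambda>n. (c ^ n /\<^sub>R fact n) * r v b) sums (exp c * r v b)"
      by (intro sums_mult2 exp_converges)
    moreover have "(c ^ n /\<^sub>R fact n) * r v b = T v b n" for n
      by (simp add: T_def eig[OF that] r scaleR_conv_of_real divide_inverse)
    ultimately show ?thesis by simp
  qed
  have summable: "summable (T v b)" for v b
  proof -
    have "v \<in> span {v. \<exists>c. A v = scale c v}" using diag by simp
    then show ?thesis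
    proof (induction rule: span_induct_alt)
      case base
      have "T 0 b n = 0" for n using T(2)[of 0 0 b] by (simp add: fun_eq_iff)
      then show ?case by (simp add: fun_eq_iff)
    next
      case (step a x y)
      then have "summable (T x b)" using T_eig sums_summable by blast
      then show ?case unfolding T using step by (intro summable_add summable_mult)
    qed
  qed
  have E: "endo_exp scale A v = (\<Sum>b\<in>B. scale (\<Sum>n. T v b n) b)" for v
    by (simp add: endo_exp_def Let_def B_def r_def T_def)
  show "Vector_Spaces.linear scale scale (endo_exp scale A)"
    unfolding Vector_Spaces.linear_iff
    by (auto simp: vector_space_axioms E T suminf_mult suminf_add[symmetric] summable
        scale_left_distrib sum.distrib scale_sum_right)
  show "endo_exp scale A v = scale (exp c) v" if "A v = scale c v"
  proof -
    have "endo_exp scale A v = (\<Sum>b\<in>B. scale (exp c * r v b) b)"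
      using sums_unique[OF T_eig[OF that]] by (simp add: E)
    also have "\<dots> = scale (exp c) (\<Sum>b\<in>B. scale (r v b) b)" by (simp add: scale_sum_right)
    finally show ?thesis using B by (simp add: r_def sum_representation_eq)
  qed
qed

lemma exp_2pi_i_div_eq_iff:
  fixes k m n :: int
  assumes "k \<noteq> 0"
  shows "exp (2 * of_real pi * \<i> / of_int k * of_int m) = exp (2 * of_real pi * \<i> / of_int k * of_int n)
    \<longleftrightarrow> k dvd m - n"
proof -
  \<comment> \<open>Cancellation of the period 2 pi i, stated for an abstract nonzero
    \<open>c\<close>.\<close>
  have *: "c / k * m = c / k * n + x * c \<longleftrightarrow> m = n + x * k" if "c \<noteq> 0" "k \<noteq> 0" for c k m n x :: complex
  proof -
    have "c / k * m = c / k * n + x * c \<longleftrightarrow> c * m = c * (n + x * k)"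
      using that(2) by (simp add: field_simps)
    then show ?thesis using that(1) by simp
  qed
  have "exp (2 * of_real pi * \<i> / of_int k * of_int m) = exp (2 * of_real pi * \<i> / of_int k * of_int n)
    \<longleftrightarrow> (\<exists>x::int. 2 * of_real pi * \<i> / of_int k * of_int m
        = 2 * of_real pi * \<i> / of_int k * of_int n + of_int x * (2 * of_real pi * \<i>) )"
    by (simp add: exp_eq mult_ac)
  also have "\<dots> \<longleftrightarrow> (\<exists>x::int. (of_int m :: complex) = of_int n + of_int x * of_int k)"
    using assms by (subst *) auto
  also have "\<dots> \<longleftrightarrow> (\<exists>x::int. m = n + x * k)"
    by (simp only: of_int_eq_iff flip: of_int_mult of_int_add)
  also have "\<dots> \<longleftrightarrow> k dvd m - n"
    by (auto simp: dvd_def algebra_simps)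
  finally show ?thesis .
qed

section \<open>Action of the Coxeter automorphism on root spaces\<close>

context hermitian_cartan_base
begin

abbreviation \<sigma> :: "'a \<Rightarrow> 'a" where "\<sigma> \<equiv> coxeter_automorphism H N \<alpha>"

abbreviation k :: int where "k \<equiv> coxeter_number H N \<alpha>"

text \<open>The \<open>m\<close>-th power of the primitive \<open>k\<close>-th root of unity exp (2
  pi i / k).\<close>

definition phase :: "int \<Rightarrow> complex" where
  "phase m = exp (2 * of_real pi * \<i> / of_int k * of_int m)"

lemma k_gt_1: "1 < k"
  using max_height_pos by (simp add: coxeter_number_eq)

lemma phase_eq_iff: "phase m = phase n \<longleftrightarrow> k dvd m - n"
  using exp_2pi_i_div_eq_iff[of k m n] k_gt_1 by (simp add: phase_def)

lemma cnj_phase: "cnj (phase m) = phase (- m)"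
  by (simp add: phase_def exp_cnj)

lemma phase_power_k: "phase m ^ nat k = 1"
proof -
  have "phase m ^ nat k = phase (k * m)"
    using k_gt_1 by (simp add: phase_def field_simps flip: exp_of_nat_mult)
  also have "\<dots> = phase 0" by (simp add: phase_eq_iff)
  finally show ?thesis by (simp add: phase_def)
qed

text \<open>The exponent \<open>x\<close> is a multiple of \<open>rho\<close>, so its adjoint action
  is zero on \<open>H\<close> and a multiple of the height on each root space; its exponential is
  then read off on eigenvectors.\<close>

lemma
  shows coxeter_linear: "Vector_Spaces.linear scale scale \<sigma>"
    and coxeter_cartan: "h \<in> H \<Longrightarrow> \<sigma> h = h"
    and coxeter_root: "\<beta> \<in> roots H \<Longrightarrow> X \<in> weight_space \<beta> \<Longrightarrow> \<sigma> X = scale (phase (height N \<alpha> \<beta>)) X"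
proof -
  define x where "x = scale (2 * of_real pi * \<i> / of_int k) rho"
  have \<sigma>: "\<sigma> = endo_exp scale (bracket x)"
    by (simp add: coxeter_automorphism_def Ad_exp_def x_def rho_def)
  have cartan: "bracket x h = scale 0 h" if "h \<in> H" for h
    using that rho_in H_abelian by (simp add: x_def bracket_scale_left)
  have root: "bracket x X = scale (2 * of_real pi * \<i> / of_int k * of_int (height N \<alpha> \<beta>)) X"
    if "\<beta> \<in> roots H" "X \<in> weight_space \<beta>" for \<beta> X
    using that rho_in root_rho[OF that(1)] by (simp add: x_def bracket_scale_left weight_space_def)
  have "v \<in> span {v. \<exists>c. bracket x v = scale c v}" for v
    by (induction v rule: root_decomposition_induct)
      (use cartan root in \<open>blast intro: span_add span_base\<close>)+
  then have diag: "span {v. \<exists>c. bracket x v = scale c v} = UNIV" by blast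
  note exp = vector_space_axioms finite_dim bracket_linear_right diag
  show "Vector_Spaces.linear scale scale \<sigma>" unfolding \<sigma> by (rule endo_exp_linear[OF exp])
  show "\<sigma> h = h" if "h \<in> H"
    unfolding \<sigma> using endo_exp_eigenvector[OF exp cartan[OF that]] by simp
  show "\<sigma> X = scale (phase (height N \<alpha> \<beta>)) X" if "\<beta> \<in> roots H" "X \<in> weight_space \<beta>"
    unfolding \<sigma> phase_def by (rule endo_exp_eigenvector[OF exp root[OF that]])
qed

lemma coxeter_add: "\<sigma> (x + y) = \<sigma> x + \<sigma> y" and coxeter_scale: "\<sigma> (scale c x) = scale c (\<sigma> x)"
  using coxeter_linear by (simp_all add: Vector_Spaces.linear_iff)

text \<open>On a root space \<tau> conjugates the phase and also negates the height; the two effects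
  cancel.\<close>

lemma coxeter_tau: "\<sigma> (\<tau> v) = \<tau> (\<sigma> v)"
proof (induction v rule: root_decomposition_induct)
  case (add x y)
  then show ?case by (simp add: tau_add coxeter_add)
next
  case (cartan h)
  then show ?case using tau_H by (simp add: coxeter_cartan)
next
  case (root \<beta> X)
  then show ?case
    using coxeter_root[OF neg_root[OF root(1)] tau_weight_space[OF root(2)]]
    by (simp add: coxeter_root tau_scale cnj_phase height_neg)
qed

lemma coxeter_power_k: "(\<sigma> ^^ nat k) v = v"
proof (induction v rule: root_decomposition_induct)
  case (add x y)
  have "(\<sigma> ^^ n) (x + y) = (\<sigma> ^^ n) x + (\<sigma> ^^ n) y" for n
    by (induction n) (simp_all add: coxeter_add)
  then show ?case using add by simp
next
  case (cartan h)
  have "(\<sigma> ^^ n) h = h" for n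
    by (induction n) (simp_all add: coxeter_cartan cartan)
  then show ?case .
next
  case (root \<beta> X)
  have "(\<sigma> ^^ n) X = scale (phase (height N \<alpha> \<beta>) ^ n) X" for n
    by (induction n) (simp_all add: coxeter_root[OF root] coxeter_scale mult.commute)
  then show ?case by (simp add: phase_power_k)
qed

lemma nodes_eq: "extended_nodes H N \<alpha> = {\<beta> \<in> roots H. k dvd height N \<alpha> \<beta> - 1}"
proof (intro equalityI subsetI)
  fix \<beta> assume "\<beta> \<in> extended_nodes H N \<alpha>"
  moreover have "k dvd - max_height - 1" by (rule dvdI[of _ _ "- 1"]) (simp add: coxeter_number_eq)
  ultimately show "\<beta> \<in> {\<beta> \<in> roots H. k dvd height N \<alpha> \<beta> - 1}"
    using simple_root height_simple lowest_root_in height_lowest_root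
    by (auto simp: extended_nodes_def)
next
  fix \<beta> assume \<beta>: "\<beta> \<in> {\<beta> \<in> roots H. k dvd height N \<alpha> \<beta> - 1}"
  then obtain q where q: "height N \<alpha> \<beta> - 1 = k * q" by auto
  \<comment> \<open>Heights lie between 1 - k and k - 1, so only q = 0 and q = -1 remain: the simple
    roots and the lowest root.\<close>
  have "- k \<le> k * q" "k * q < k"
    using q \<beta> height_le_max[of \<beta>] height_ge_min[of \<beta>] by (auto simp: coxeter_number_eq)
  then have "k * (- 1) \<le> k * q" "k * q < k * 1" by simp_all
  then have "- 1 \<le> q" "q < 1"
    using k_gt_1 mult_le_cancel_left_pos[of k "- 1" q] mult_less_cancel_left_pos[of k q 1] by auto
  then consider "q = 0" | "q = - 1" by force
  then show "\<beta> \<in> extended_nodes H N \<alpha>"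
  proof cases
    case 1
    then show ?thesis using q \<beta> height_one_simple[of \<beta>] by (auto simp: extended_nodes_def)
  next
    case 2
    then have "height N \<alpha> \<beta> = - max_height" using q by (simp add: coxeter_number_eq)
    then have "\<beta> = lowest_root H N \<alpha>"
      using \<beta> lowest_root_unique lowest_root_in height_lowest_root by blast
    then show ?thesis by (simp add: extended_nodes_def)
  qed
qed

text \<open>Both sides are compared with a third condition, \<open>?heights\<close>: composition
  with \<Theta> preserves the height of every root modulo \<open>k\<close>.\<close>

lemma coxeter_commute_iff:
  assumes add: "\<And>x y. \<Theta> (x + y) = \<Theta> x + \<Theta> y" and scl: "\<And>c x. \<Theta> (scale c x) = scale c (\<Theta> x)"
    and br: "\<And>x y. \<Theta> (bracket x y) = bracket (\<Theta> x) (\<Theta> y)"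
    and inv: "\<And>x. \<Theta> (\<Theta> x) = x" and \<Theta>H: "\<And>h. h \<in> H \<Longrightarrow> \<Theta> h \<in> H"
  shows "\<sigma> \<circ> \<Theta> = \<Theta> \<circ> \<sigma> \<longleftrightarrow>
    bij_betw (\<lambda>\<beta>. \<beta> \<circ> \<Theta>) (extended_nodes H N \<alpha>) (extended_nodes H N \<alpha>)"
proof -
  have weight: "\<Theta> X \<in> weight_space (\<mu> \<circ> \<Theta>)" if "X \<in> weight_space \<mu>" for X \<mu>
  proof -
    have "bracket h (\<Theta> X) = scale (\<mu> (\<Theta> h)) (\<Theta> X)" if "h \<in> H" for h
      using \<open>X \<in> weight_space \<mu>\<close> \<Theta>H[OF that] br[of "\<Theta> h" X] by (simp add: weight_space_def inv scl)
    then show ?thesis by (simp add: weight_space_def)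
  qed
  have zero: "\<Theta> x = 0 \<longleftrightarrow> x = 0" for x
    using scl[of 0 0] inv[of x] by auto
  have root: "\<beta> \<circ> \<Theta> \<in> roots H" if \<beta>: "\<beta> \<in> roots H" for \<beta>
  proof -
    obtain X where X: "X \<in> weight_space \<beta>" "X \<noteq> 0" using \<beta> by (rule root_vector)
    obtain h where h: "h \<in> H" "\<beta> h \<noteq> 0" using \<beta> by (auto simp: roots_def)
    have "(\<lambda>x. if x \<in> H then (\<beta> \<circ> \<Theta>) x else 0) \<in> roots H"
      by (rule rootI[OF weight[OF X(1)], of "\<Theta> h"]) (use X h \<Theta>H inv zero in auto)
    moreover have "\<beta> (\<Theta> x) = 0" if "x \<notin> H" for x
    proof -
      have "\<Theta> x \<notin> H" using that \<Theta>H[of "\<Theta> x"] inv by metis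
      then show ?thesis using \<beta> by (simp add: roots_def dual_on_def)
    qed
    then have "(\<lambda>x. if x \<in> H then (\<beta> \<circ> \<Theta>) x else 0) = \<beta> \<circ> \<Theta>" by auto
    ultimately show ?thesis by simp
  qed
  have commute_iff: "\<sigma> (\<Theta> X) = \<Theta> (\<sigma> X) \<longleftrightarrow> k dvd height N \<alpha> (\<beta> \<circ> \<Theta>) - height N \<alpha> \<beta>"
    if "\<beta> \<in> roots H" "X \<in> weight_space \<beta>" "X \<noteq> 0" for \<beta> X
    using coxeter_root[OF root[OF that(1)] weight[OF that(2)]] coxeter_root[OF that(1,2)] that(3)
    by (simp add: scl zero flip: phase_eq_iff)
  let ?heights = "\<forall>\<beta>\<in>roots H. k dvd height N \<alpha> (\<beta> \<circ> \<Theta>) - height N \<alpha> \<beta>"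
  have 1: "\<sigma> \<circ> \<Theta> = \<Theta> \<circ> \<sigma> \<longleftrightarrow> ?heights"
  proof
    assume eq: "\<sigma> \<circ> \<Theta> = \<Theta> \<circ> \<sigma>"
    show ?heights
    proof
      fix \<beta> assume \<beta>: "\<beta> \<in> roots H"
      obtain X where "X \<in> weight_space \<beta>" "X \<noteq> 0" using \<beta> by (rule root_vector)
      then show "k dvd height N \<alpha> (\<beta> \<circ> \<Theta>) - height N \<alpha> \<beta>"
        using commute_iff[OF \<beta>] fun_cong[OF eq, of X] by simp
    qed
  next
    assume R: ?heights
    have "\<sigma> (\<Theta> v) = \<Theta> (\<sigma> v)" for v
    proof (induction v rule: root_decomposition_induct)
      case (add x y)
      then show ?case by (simp add: assms(1) coxeter_add)
    next
      case (cartan h)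
      then show ?case by (simp add: coxeter_cartan \<Theta>H)
    next
      case (root \<beta> X)
      have "\<sigma> 0 = 0" using coxeter_scale[of 0 0] by simp
      then show ?case using commute_iff[OF root] R root(1) zero[of 0] by (cases "X = 0") auto
    qed
    then show "\<sigma> \<circ> \<Theta> = \<Theta> \<circ> \<sigma>" by auto
  qed
  have involutive: "\<beta> \<circ> \<Theta> \<circ> \<Theta> = \<beta>" for \<beta> :: "'a \<Rightarrow> complex" by (auto simp: inv)
  \<comment> \<open>Composition with \<Theta> is its own inverse, so mapping a set into itself
    already permutes it.\<close>
  have 2: "bij_betw (\<lambda>\<beta>. \<beta> \<circ> \<Theta>) S S \<longleftrightarrow> (\<forall>\<beta>\<in>S. \<beta> \<circ> \<Theta> \<in> S)" for S :: "('a \<Rightarrow> complex) set"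
  proof
    assume "bij_betw (\<lambda>\<beta>. \<beta> \<circ> \<Theta>) S S"
    then show "\<forall>\<beta>\<in>S. \<beta> \<circ> \<Theta> \<in> S" by (auto dest: bij_betw_apply)
  next
    assume "\<forall>\<beta>\<in>S. \<beta> \<circ> \<Theta> \<in> S"
    then show "bij_betw (\<lambda>\<beta>. \<beta> \<circ> \<Theta>) S S"
      by (intro bij_betw_byWitness[where f' = "\<lambda>\<beta>. \<beta> \<circ> \<Theta>"]) (simp_all add: involutive image_subset_iff)
  qed
  have 3: "?heights \<longleftrightarrow> (\<forall>\<beta>\<in>extended_nodes H N \<alpha>. \<beta> \<circ> \<Theta> \<in> extended_nodes H N \<alpha>)"
  proof
    assume R: ?heights
    show "\<forall>\<beta>\<in>extended_nodes H N \<alpha>. \<beta> \<circ> \<Theta> \<in> extended_nodes H N \<alpha>"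
    proof
      fix \<beta> assume "\<beta> \<in> extended_nodes H N \<alpha>"
      then have \<beta>: "\<beta> \<in> roots H" "k dvd height N \<alpha> \<beta> - 1" by (auto simp: nodes_eq)
      have "k dvd (height N \<alpha> (\<beta> \<circ> \<Theta>) - height N \<alpha> \<beta>) + (height N \<alpha> \<beta> - 1)"
        using R \<beta> by (intro dvd_add) auto
      then show "\<beta> \<circ> \<Theta> \<in> extended_nodes H N \<alpha>" using root[OF \<beta>(1)] by (simp add: nodes_eq)
    qed
  next
    assume perm: "\<forall>\<beta>\<in>extended_nodes H N \<alpha>. \<beta> \<circ> \<Theta> \<in> extended_nodes H N \<alpha>"
    show ?heights
    proof
      fix \<beta> assume \<beta>: "\<beta> \<in> roots H"
      obtain n :: "nat \<Rightarrow> int" where n: "\<And>x. \<beta> x = (\<Sum>i=1..N. of_int (n i) * \<alpha> i x)"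
        using base \<beta> by (auto simp: simple_roots_def)
      have "of_int (height N \<alpha> (\<beta> \<circ> \<Theta>)) = (\<beta> \<circ> \<Theta>) rho" by (simp only: root_rho[OF root[OF \<beta>]])
      also have "\<dots> = (\<Sum>i=1..N. of_int (n i) * (\<alpha> i \<circ> \<Theta>) rho)" by (simp add: n)
      also have "\<dots> = (\<Sum>i=1..N. of_int (n i) * of_int (height N \<alpha> (\<alpha> i \<circ> \<Theta>)))"
        by (intro sum.cong refl) (simp only: root_rho[OF root[OF simple_root]])
      also have "\<dots> = of_int (\<Sum>i=1..N. n i * height N \<alpha> (\<alpha> i \<circ> \<Theta>))" by simp
      finally have "height N \<alpha> (\<beta> \<circ> \<Theta>) = (\<Sum>i=1..N. n i * height N \<alpha> (\<alpha> i \<circ> \<Theta>))"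
        by (simp only: of_int_eq_iff)
      \<comment> \<open>Heights are values at \<open>rho\<close> and hence additive, so the
        difference is an integral combination of the differences for simple roots, where
        \<open>nodes_eq\<close> gives divisibility.\<close>
      then have "height N \<alpha> (\<beta> \<circ> \<Theta>) - height N \<alpha> \<beta> = (\<Sum>i=1..N. n i * (height N \<alpha> (\<alpha> i \<circ> \<Theta>) - 1))"
        by (simp add: height_eqI[of \<beta> n, OF n] algebra_simps sum_subtractf)
      also have "k dvd \<dots>"
      proof (intro dvd_sum dvd_mult)
        fix i assume "i \<in> {1..N}"
        then have "\<alpha> i \<circ> \<Theta> \<in> extended_nodes H N \<alpha>" using perm by (simp add: extended_nodes_def)
        then show "k dvd height N \<alpha> (\<alpha> i \<circ> \<Theta>) - 1" by (simp add: nodes_eq)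
      qed
      finally show "k dvd height N \<alpha> (\<beta> \<circ> \<Theta>) - height N \<alpha> \<beta>" .
    qed
  qed
  show ?thesis unfolding 1 2 3 ..
qed

end

section \<open>The Killing form and Cartan involutions\<close>

context finite_dim_lie_algebra
begin

lemma killing_commute: "killing x y = killing y x"
  unfolding killing_def by (rule endo_trace_comp_commute[OF finite_dim bracket_linear_right bracket_linear_right])

lemma
  shows killing_add_left: "killing (x + y) z = killing x z + killing y z"
    and killing_scale_left: "killing (scale c x) z = c * killing x z"
  using endo_trace_add[of "bracket x \<circ> bracket z" "bracket y \<circ> bracket z"]
    endo_trace_scale[of c "bracket x \<circ> bracket z"]
  by (simp_all add: killing_def comp_def bracket_linear_simps)

text \<open>Writing ad of a bracket as a commutator, both sides share one triple product, and the
  remaining two agree by cyclicity of the trace.\<close>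

lemma killing_invariant: "killing (bracket x y) z = killing x (bracket y z)"
proof -
  have ad: "bracket (bracket a b) c = bracket a (bracket b c) - bracket b (bracket a c)" for a b c
    using bracket_derivation[of a b c] by simp
  have lin: "Vector_Spaces.linear scale scale (bracket a \<circ> bracket b)" for a b
    using bracket_linear_right bracket_linear_right by (rule Vector_Spaces.linear_compose)
  have "killing (bracket x y) z =
      endo_trace (bracket x \<circ> (bracket y \<circ> bracket z)) - endo_trace (bracket y \<circ> (bracket x \<circ> bracket z))"
    unfolding killing_def endo_trace_diff[symmetric] by (simp add: comp_def ad)
  also have "endo_trace (bracket y \<circ> (bracket x \<circ> bracket z)) = endo_trace (bracket x \<circ> bracket z \<circ> bracket y)"
    by (rule endo_trace_comp_commute[OF finite_dim bracket_linear_right lin])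
  also have "endo_trace (bracket x \<circ> (bracket y \<circ> bracket z)) - endo_trace (bracket x \<circ> bracket z \<circ> bracket y)
      = killing x (bracket y z)"
    unfolding killing_def endo_trace_diff[symmetric]
    by (simp add: comp_def ad bracket_diff_right)
  finally show ?thesis .
qed

text \<open>ad (f x) is the conjugate of ad x by \<open>f\<close>, and the trace is invariant under
  conjugation.\<close>

lemma killing_automorphism:
  assumes "lie_automorphism f"
  shows "killing (f x) (f y) = killing x y"
proof -
  have f: "Vector_Spaces.linear scale scale f" "bij f" "\<And>x y. f (bracket x y) = bracket (f x) (f y)"
    using assms by (auto simp: lie_automorphism_def)
  interpret f: Vector_Spaces.linear scale scale f by fact
  have finv: "f (inv f x) = x" "inv f (f x) = x" for x
    using f(2) by (simp_all add: bij_is_surj surj_f_inv_f bij_is_inj)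
  have inv_f: "Vector_Spaces.linear scale scale (inv f)"
    unfolding Vector_Spaces.linear_iff
    using vector_space_axioms finv f.add[of "inv f _" "inv f _"] f.scale[of _ "inv f _"] by metis
  have lin: "Vector_Spaces.linear scale scale (bracket x \<circ> bracket y \<circ> inv f)"
    by (rule Vector_Spaces.linear_compose[OF inv_f
          Vector_Spaces.linear_compose[OF bracket_linear_right bracket_linear_right]])
  have "killing (f x) (f y) = endo_trace (f \<circ> (bracket x \<circ> bracket y \<circ> inv f))"
    unfolding killing_def by (rule arg_cong[where f = endo_trace]) (simp add: fun_eq_iff f(3) finv)
  also have "\<dots> = endo_trace ((bracket x \<circ> bracket y \<circ> inv f) \<circ> f)"
    by (rule endo_trace_comp_commute[OF finite_dim f(1) lin])
  also have "\<dots> = killing x y"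
    unfolding killing_def by (rule arg_cong[where f = endo_trace]) (simp add: fun_eq_iff finv)
  finally show ?thesis .
qed

end

section \<open>Cartan subalgebras stable under a Cartan involution\<close>

locale cartan_involution_pair = finite_dim_lie_algebra scaleR br
  for br :: "'a::real_vector \<Rightarrow> 'a \<Rightarrow> 'a" +
  fixes \<Theta> :: "'a \<Rightarrow> 'a" and t :: "'a set"
  assumes involution: "cartan_involution br \<Theta>"
    and cartan: "cartan_subalgebra t"
    and stable: "\<Theta> ` t = t"
begin

lemma
  shows Theta_add: "\<Theta> (x + y) = \<Theta> x + \<Theta> y"
    and Theta_scale: "\<Theta> (r *\<^sub>R x) = r *\<^sub>R \<Theta> x"
    and Theta_bracket: "\<Theta> (br x y) = br (\<Theta> x) (\<Theta> y)"
    and Theta_Theta: "\<Theta> (\<Theta> x) = x"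
  using involution
  by (auto simp: cartan_involution_def lie_automorphism_def Vector_Spaces.linear_iff fun_eq_iff)

lemma Theta_minus: "\<Theta> (- x) = - \<Theta> x"
  using Theta_scale[of "- 1" x] by simp

lemma Theta_diff: "\<Theta> (x - y) = \<Theta> x - \<Theta> y"
  using Theta_add[of x "- y"] by (simp add: Theta_minus)

definition ip :: "'a \<Rightarrow> 'a \<Rightarrow> real" where "ip x y = - killing x (\<Theta> y)"

lemma ip_commute: "ip x y = ip y x"
proof -
  have "killing x (\<Theta> y) = killing (\<Theta> x) (\<Theta> (\<Theta> y))"
    using involution by (intro killing_automorphism[symmetric]) (simp add: cartan_involution_def)
  then show ?thesis by (simp add: ip_def Theta_Theta killing_commute)
qed

lemma
  shows ip_add_left: "ip (x + y) z = ip x z + ip y z"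
    and ip_scale_left: "ip (r *\<^sub>R x) z = r * ip x z"
  by (simp_all add: ip_def killing_add_left killing_scale_left)

lemma
  shows ip_add_right: "ip z (x + y) = ip z x + ip z y"
    and ip_scale_right: "ip z (r *\<^sub>R x) = r * ip z x"
  by (simp_all add: ip_commute[of z] ip_add_left ip_scale_left)

lemma
  shows ip_minus_left: "ip (- x) z = - ip x z"
    and ip_minus_right: "ip z (- x) = - ip z x"
  using ip_scale_left[of "- 1" x z] ip_scale_right[of z "- 1" x] by simp_all

lemma
  shows ip_diff_left: "ip (x - y) z = ip x z - ip y z"
    and ip_diff_right: "ip z (x - y) = ip z x - ip z y"
  using ip_add_left[of x "- y" z] ip_add_right[of z x "- y"]
  by (simp_all add: ip_minus_left ip_minus_right)

lemma ip_pos: "x \<noteq> 0 \<Longrightarrow> 0 < ip x x"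
  using involution by (simp add: ip_def cartan_involution_def)

lemma ip_nonneg: "0 \<le> ip x x"
  using ip_pos[of x] ip_scale_left[of 0 0 0] by (cases "x = 0") auto

text \<open>Invariance of the Killing form moves ad z to the other side, where \<Theta> turns
  \<open>z\<close> into \<Theta> z.\<close>

lemma ip_bracket: "ip (br z x) y = - ip x (br (\<Theta> z) y)"
proof -
  have "ip (br z x) y = - ip (br x z) y" by (subst bracket_antisym) (simp add: ip_minus_left)
  also have "\<dots> = killing x (br z (\<Theta> y))" by (simp add: ip_def killing_invariant)
  also have "\<dots> = - ip x (br (\<Theta> z) y)" by (simp add: ip_def Theta_bracket Theta_Theta)
  finally show ?thesis .
qed

lemma subspace_t: "subspace t"
  using cartan by (simp add: cartan_subalgebra_def lie_subalgebra_def)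

lemma Theta_t: "h \<in> t \<Longrightarrow> \<Theta> h \<in> t"
  using stable by blast

text \<open>An element that centralizes \<open>t\<close> normalizes it, and \<open>t\<close> is its
  own normalizer.\<close>

lemma t_self_centralizing:
  assumes "\<And>h. h \<in> t \<Longrightarrow> br h x = 0"
  shows "x \<in> t"
proof -
  have "br x h \<in> t" if "h \<in> t" for h
    using assms[OF that] subspace_0[OF subspace_t] by (subst bracket_antisym) simp
  then have "x \<in> normalizer t" by (simp add: normalizer_def)
  then show ?thesis using cartan by (simp add: cartan_subalgebra_def)
qed

text \<open>On \<open>t\<close> the operator \<open>ad h\<close> is nilpotent, and for an eigenvector \<open>h\<close> of \<open>\<Theta>\<close> it is also
  symmetric or skew; hence it vanishes there.\<close>

lemma t_abelian_eigenvector: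
  assumes h: "h \<in> t" "\<Theta> h = s *\<^sub>R h" and x: "x \<in> t"
  shows "br h x = 0"
proof -
  obtain n where n: "lower_central t n = {0}"
    using cartan by (auto simp: cartan_subalgebra_def nilpotent_def)
  have "(br h ^^ m) x \<in> lower_central t m" for m
  proof (induction m)
    case (Suc m)
    then show ?case using h(1) by (auto intro!: span_base)
  qed (use x in simp)
  then have nil: "(br h ^^ n) x = 0" using n by blast
  \<comment> \<open>The adjoint of ad h is a multiple of ad h, so ad h and its square have the same
    kernel; this lowers the exponent of nilpotency to 1.\<close>
  have ker: "br h y = 0" if "br h (br h y) = 0" for y
  proof -
    have "ip (br h y) (br h y) = - ip y (br (\<Theta> h) (br h y))" by (rule ip_bracket)
    also have "\<dots> = 0" using that ip_scale_right[of y 0 0] by (simp add: h(2) bracket_scale_left)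
    finally show ?thesis using ip_pos by force
  qed
  have "br h x = 0" if "(br h ^^ Suc m) x = 0" for m
    using that by (induction m) (use ker in auto)
  moreover have "(br h ^^ Suc n) x = 0" using nil by (simp add: bracket_zero_right)
  ultimately show ?thesis by blast
qed

text \<open>\<open>2 h\<close> is the sum of the \<Theta>-eigenvectors \<open>h + \<Theta> h\<close>
  and \<open>h - \<Theta> h\<close>, both in \<open>t\<close>.\<close>

lemma t_abelian:
  assumes "h \<in> t" "x \<in> t"
  shows "br h x = 0"
proof -
  have "h + \<Theta> h \<in> t" "h - \<Theta> h \<in> t"
    using assms Theta_t subspace_add[OF subspace_t] subspace_diff[OF subspace_t] by auto
  then have "br (h + \<Theta> h) x = 0" "br (h - \<Theta> h) x = 0"
    using assms t_abelian_eigenvector[of "h + \<Theta> h" 1 x] t_abelian_eigenvector[of "h - \<Theta> h" "- 1" x]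
    by (simp_all add: Theta_add Theta_diff Theta_Theta add.commute)
  then have "br ((h + \<Theta> h) + (h - \<Theta> h)) x = 0" by (simp only: bracket_add_left add_0_left)
  moreover have "(h + \<Theta> h) + (h - \<Theta> h) = 2 *\<^sub>R h" by (simp add: scaleR_2)
  ultimately show ?thesis by (simp only: bracket_scale_left) simp
qed

text \<open>Its fixed points are the \<open>x + i y\<close> with \<Theta> x = x and \<Theta> y = -y,
  that is, the compact real form built from the two eigenspaces of \<Theta>.\<close>

definition compact_conj :: "'a \<times> 'a \<Rightarrow> 'a \<times> 'a" where
  "compact_conj = (\<lambda>(x, y). (\<Theta> x, - \<Theta> y))"

text \<open>The sesquilinear extension of \<open>ip\<close>, linear in the first argument.\<close>

definition hermitian_form :: "'a \<times> 'a \<Rightarrow> 'a \<times> 'a \<Rightarrow> complex" where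
  "hermitian_form = (\<lambda>(x, y) (u, v). Complex (ip x u + ip y v) (ip y u - ip x v))"

lemma complexification_finite_dim: "\<exists>B. finite B \<and> module.span cscale B = (UNIV :: ('a \<times> 'a) set)"
proof -
  interpret C: vector_space "cscale :: complex \<Rightarrow> 'a \<times> 'a \<Rightarrow> 'a \<times> 'a"
    by (rule vector_space_cscale)
  obtain B where B: "finite B" "span B = UNIV" using finite_dim by blast
  define B' where "B' = (\<lambda>x. (x, 0 :: 'a)) ` B"
  have re: "(x, 0) \<in> C.span B'" for x
  proof -
    have "x \<in> span B" using B by simp
    then show ?thesis
    proof (induction rule: span_induct_alt)
      case base
      then show ?case using C.span_zero by (simp add: zero_prod_def)
    next
      case (step c x y)
      then have "cscale (of_real c) (x, 0) + (y, 0) \<in> C.span B'"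
        by (intro C.span_add C.span_scale[OF C.span_base]) (simp_all add: B'_def)
      moreover have "cscale (of_real c) (x, 0) + (y, 0) = (c *\<^sub>R x + y, 0)" by (simp add: cscale_def)
      ultimately show ?case by simp
    qed
  qed
  have "(x, 0) + cscale \<i> (y, 0) = (x, y)" for x y :: 'a by (simp add: cscale_def)
  then have "(x, y) \<in> C.span B'" for x y
    using C.span_add[OF re[of x] C.span_scale[OF re[of y], of \<i>]] by simp
  then have "C.span B' = UNIV" by auto
  then show ?thesis using B(1) by (auto simp: B'_def)
qed

text \<open>Each requirement reduces to real and imaginary parts; the essential inputs are
  \<open>ip_bracket\<close>, \<open>t_abelian\<close> and
  \<open>t_self_centralizing\<close>.\<close>

lemma hermitian_cartan_complexification:
  assumes "lie_algebra.simple cscale (cbracket br)"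
  shows "hermitian_cartan cscale (cbracket br) compact_conj hermitian_form (t \<times> t)"
proof -
  interpret C: complex_lie_algebra cscale "cbracket br"
    by (rule complex_lie_algebra_complexification) (rule lie_algebra_axioms)
  note ip = ip_add_left ip_add_right ip_scale_left ip_scale_right ip_diff_left ip_diff_right
    ip_minus_left ip_minus_right
  note br = bracket_linear_simps bracket_diff_left bracket_diff_right bracket_minus_left bracket_minus_right
  show ?thesis
  proof unfold_locales
    show "\<exists>B. finite B \<and> C.span B = UNIV" by (rule complexification_finite_dim)
    show "C.simple" by fact
    fix x y z :: "'a \<times> 'a" and c :: complex
    show "compact_conj (compact_conj x) = x"
      by (cases x) (simp add: compact_conj_def Theta_Theta Theta_minus)
    show "compact_conj (x + y) = compact_conj x + compact_conj y"
      by (cases x; cases y) (simp add: compact_conj_def Theta_add)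
    show "compact_conj (cscale c x) = cscale (cnj c) (compact_conj x)"
      by (cases x) (simp add: compact_conj_def cscale_def Theta_add Theta_diff Theta_scale)
    show "compact_conj (cbracket br x y) = cbracket br (compact_conj x) (compact_conj y)"
      by (cases x; cases y)
        (simp add: compact_conj_def cbracket_def Theta_add Theta_diff Theta_bracket Theta_minus br)
    show "hermitian_form (x + y) z = hermitian_form x z + hermitian_form y z"
      by (cases x; cases y; cases z) (simp add: hermitian_form_def ip complex_eq_iff)
    show "hermitian_form (cscale c x) z = c * hermitian_form x z"
      by (cases x; cases z) (simp add: hermitian_form_def cscale_def ip complex_eq_iff algebra_simps)
    show "hermitian_form y x = cnj (hermitian_form x y)"
      by (cases x; cases y) (simp add: hermitian_form_def complex_eq_iff ip_commute)
    show "x = 0" if "hermitian_form x x = 0"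
    proof -
      have "ip (fst x) (fst x) + ip (snd x) (snd x) = 0"
        using that by (cases x) (simp add: hermitian_form_def complex_eq_iff)
      then have "ip (fst x) (fst x) = 0" "ip (snd x) (snd x) = 0"
        using ip_nonneg[of "fst x"] ip_nonneg[of "snd x"] by linarith+
      then show ?thesis using ip_pos by (metis less_irrefl prod_eq_iff fst_zero snd_zero)
    qed
    show "hermitian_form (cbracket br z x) y = - hermitian_form x (cbracket br (compact_conj z) y)"
      by (cases x; cases y; cases z)
        (simp add: hermitian_form_def cbracket_def compact_conj_def ip br ip_bracket
          complex_eq_iff Theta_minus)
    show "C.subspace (t \<times> t)"
      using subspace_t by (auto simp: C.subspace_def subspace_def cscale_def zero_prod_def subspace_diff[OF subspace_t])
    show "compact_conj h \<in> t \<times> t" if "h \<in> t \<times> t" for h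
      using that Theta_t subspace_neg[OF subspace_t] by (auto simp: compact_conj_def)
    show "cbracket br h h' = 0" if "h \<in> t \<times> t" "h' \<in> t \<times> t" for h h'
      using that by (auto simp: cbracket_def t_abelian zero_prod_def)
    show "x \<in> t \<times> t" if "\<And>h. h \<in> t \<times> t \<Longrightarrow> cbracket br h x = 0"
    proof -
      have "br h (fst x) = 0 \<and> br h (snd x) = 0" if "h \<in> t" for h
        using \<open>\<And>h. h \<in> t \<times> t \<Longrightarrow> cbracket br h x = 0\<close>[of "(h, 0)"] that subspace_0[OF subspace_t]
        by (cases x) (simp add: cbracket_def bracket_zero_left zero_prod_def)
      then show ?thesis using t_self_centralizing by (cases x) auto
    qed
  qed
qed

end

section \<open>Equivalence of the three conditions\<close>

theorem proposition3p1:
  fixes br :: "'a::real_vector \<Rightarrow> 'a \<Rightarrow> 'a"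
    and t :: "'a set"
    and \<Theta> :: "'a \<Rightarrow> 'a"
    and N :: nat
    and \<alpha> :: "nat \<Rightarrow> 'a \<times> 'a \<Rightarrow> complex"
  assumes "finite_dim_lie_algebra scaleR br"
    and "lie_algebra.simple scaleR br"
    and "lie_algebra.simple cscale (cbracket br)"
    and "lie_algebra.cartan_subalgebra scaleR br t"
    and "cartan_involution br \<Theta>"
    and "\<Theta> ` t = t"
    and "complex_lie_algebra.simple_roots cscale (cbracket br) (t \<times> t) N \<alpha>"
  defines "\<sigma> \<equiv> complex_lie_algebra.coxeter_automorphism cscale (cbracket br) (t \<times> t) N \<alpha>"
    and "\<Theta>\<^sub>C \<equiv> map_prod \<Theta> \<Theta>"
    and "nodes \<equiv> complex_lie_algebra.extended_nodes cscale (cbracket br) (t \<times> t) N \<alpha>"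
  shows "(\<sigma> ` real_form = real_form \<longleftrightarrow> \<sigma> \<circ> \<Theta>\<^sub>C = \<Theta>\<^sub>C \<circ> \<sigma>) \<and>
         (\<sigma> \<circ> \<Theta>\<^sub>C = \<Theta>\<^sub>C \<circ> \<sigma> \<longleftrightarrow> bij_betw (\<lambda>\<beta>. \<beta> \<circ> \<Theta>\<^sub>C) nodes nodes)"
proof -
  interpret g: finite_dim_lie_algebra scaleR br by fact
  interpret g: cartan_involution_pair br \<Theta> t
    by unfold_locales (use assms in auto)
  interpret C: hermitian_cartan cscale "cbracket br" g.compact_conj g.hermitian_form "t \<times> t"
    by (rule g.hermitian_cartan_complexification) fact
  interpret C: hermitian_cartan_base cscale "cbracket br" g.compact_conj g.hermitian_form "t \<times> t" N \<alpha>
    by unfold_locales fact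
  have \<sigma>_add: "\<sigma> (x + y) = \<sigma> x + \<sigma> y" and \<sigma>_scale: "\<sigma> (cscale c x) = cscale c (\<sigma> x)"
    and \<sigma>_tau: "\<sigma> (g.compact_conj x) = g.compact_conj (\<sigma> x)" for x y c
    unfolding \<sigma>_def by (fact C.coxeter_add C.coxeter_scale C.coxeter_tau)+
  define conj :: "'a \<times> 'a \<Rightarrow> 'a \<times> 'a" where "conj = (\<lambda>(x, y). (x, - y))"
  have conj: "conj x = g.compact_conj (\<Theta>\<^sub>C x)" and \<Theta>\<^sub>C: "\<Theta>\<^sub>C x = g.compact_conj (conj x)" for x
    by (cases x; simp add: conj_def g.compact_conj_def \<Theta>\<^sub>C_def g.Theta_Theta g.Theta_minus)+
  have real_form: "x \<in> real_form \<longleftrightarrow> conj x = x" for x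
    by (cases x) (auto simp: real_form_def conj_def eq_neg_iff_add_eq_0 neg_eq_iff_add_eq_0 simp flip: scaleR_2)
  \<comment> \<open>\<open>conj\<close> and \<open>\<Theta>\<^sub>C\<close> differ by the compact
    conjugation, with which \<sigma> always commutes.\<close>
  have commute: "\<sigma> \<circ> \<Theta>\<^sub>C = \<Theta>\<^sub>C \<circ> \<sigma> \<longleftrightarrow> (\<forall>x. \<sigma> (conj x) = conj (\<sigma> x))"
  proof
    assume "\<sigma> \<circ> \<Theta>\<^sub>C = \<Theta>\<^sub>C \<circ> \<sigma>"
    then have "\<sigma> (\<Theta>\<^sub>C x) = \<Theta>\<^sub>C (\<sigma> x)" for x by (metis comp_apply)
    then show "\<forall>x. \<sigma> (conj x) = conj (\<sigma> x)" by (simp add: conj \<sigma>_tau)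
  next
    assume "\<forall>x. \<sigma> (conj x) = conj (\<sigma> x)"
    then have "\<sigma> (conj x) = conj (\<sigma> x)" for x by blast
    then show "\<sigma> \<circ> \<Theta>\<^sub>C = \<Theta>\<^sub>C \<circ> \<sigma>" by (intro ext) (simp add: \<Theta>\<^sub>C \<sigma>_tau)
  qed
  have "\<sigma> ` real_form = real_form \<longleftrightarrow> (\<forall>x. \<sigma> (conj x) = conj (\<sigma> x))"
  proof
    assume img: "\<sigma> ` real_form = real_form"
    have re: "conj (\<sigma> (x, 0)) = \<sigma> (x, 0)" for x
    proof -
      have "(x, 0) \<in> real_form" by (simp add: real_form_def)
      then have "\<sigma> (x, 0) \<in> real_form" using img by blast
      then show ?thesis using real_form by blast
    qed
    \<comment> \<open>A complex-linear map is determined by its values on the real form. There they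
      are real, and antilinearity of \<open>conj\<close> yields commutation everywhere.\<close>
    have split: "\<sigma> (x, y) = \<sigma> (x, 0) + cscale \<i> (\<sigma> (y, 0))" for x y
      using \<sigma>_add[of "(x, 0)" "cscale \<i> (y, 0)"] \<sigma>_scale[of \<i> "(y, 0)"] by (simp add: cscale_def)
    have conj_add: "conj (x + y) = conj x + conj y" and conj_i: "conj (cscale \<i> x) = - cscale \<i> (conj x)" for x y
      by (cases x; cases y; simp add: conj_def cscale_def)+
    have "cscale (- 1) (y, 0) = (- y, 0)" for y :: 'a by (simp add: cscale_def)
    then have "\<sigma> (- y, 0) = - \<sigma> (y, 0)" for y
      using \<sigma>_scale[of "- 1" "(y, 0)"] by (simp del: split_paired_All)
    then have "\<sigma> (x, - y) = conj (\<sigma> (x, y))" for x y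
      unfolding split[of x y] split[of x "- y"] conj_add conj_i re by simp
    then show "\<forall>x. \<sigma> (conj x) = conj (\<sigma> x)" by (auto simp: conj_def)
  next
    assume comm: "\<forall>x. \<sigma> (conj x) = conj (\<sigma> x)"
    then have inv: "\<sigma> x \<in> real_form" if "x \<in> real_form" for x
      using that real_form by metis
    \<comment> \<open>With \<open>m = k - 1\<close>, the power \<open>\<sigma> ^^ m\<close> inverts
      \<sigma> and preserves the real form, which gives surjectivity onto it.\<close>
    obtain m where m: "nat C.k = Suc m" using C.k_gt_1 by (cases "nat C.k") auto
    have "y \<in> \<sigma> ` real_form" if "y \<in> real_form" for y
    proof
      show "y = \<sigma> ((\<sigma> ^^ m) y)" using C.coxeter_power_k[of y] by (simp add: \<sigma>_def m)
      show "(\<sigma> ^^ m) y \<in> real_form" using that inv by (induction m) auto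
    qed
    then show "\<sigma> ` real_form = real_form" using inv by blast
  qed
  moreover have "\<sigma> \<circ> \<Theta>\<^sub>C = \<Theta>\<^sub>C \<circ> \<sigma> \<longleftrightarrow> bij_betw (\<lambda>\<beta>. \<beta> \<circ> \<Theta>\<^sub>C) nodes nodes"
    unfolding \<sigma>_def nodes_def
  proof (rule C.coxeter_commute_iff)
    show "\<Theta>\<^sub>C (x + y) = \<Theta>\<^sub>C x + \<Theta>\<^sub>C y" "\<Theta>\<^sub>C (cscale c x) = cscale c (\<Theta>\<^sub>C x)"
      "\<Theta>\<^sub>C (cbracket br x y) = cbracket br (\<Theta>\<^sub>C x) (\<Theta>\<^sub>C y)" "\<Theta>\<^sub>C (\<Theta>\<^sub>C x) = x" for x y c
      by (cases x; cases y; simp add: \<Theta>\<^sub>C_def cscale_def cbracket_def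
          g.Theta_add g.Theta_diff g.Theta_scale g.Theta_bracket g.Theta_Theta)+
    show "\<Theta>\<^sub>C h \<in> t \<times> t" if "h \<in> t \<times> t" for h
      using that g.Theta_t by (auto simp: \<Theta>\<^sub>C_def)
  qed
  ultimately show ?thesis unfolding commute by blast
qed

end
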